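(* Let $0<q<1$ be fixed. Suppose $\{f_n\}_{n\ge0}$ is a doubly positive sequence, let $$f(a;x)=\sum_{n=0}^{\infty}f_n\frac{(a;q)_n}{(q;q)_n}x^n$$ with radius of convergence $R_f$ in $x$, and let $$\Delta_{f}(\alpha,\beta;x)=f(q^{\mu+\alpha};x)f(q^{\mu+\beta};x)-f(q^{\mu};x)f(q^{\mu+\alpha+\beta};x).$$ Then for all $\alpha,\beta>0$, $\mu\ge0$ and $0\le x<R_f$ the following bounds hold true: $$\frac{\Gamma_q(\mu+\alpha)\Gamma_q(\mu+\beta)}{\Gamma_q(\mu)\Gamma_q(\mu+\alpha+\beta)}<\frac{f(q^{\mu};x)f(q^{\mu+\alpha+\beta};x)}{f(q^{\mu+\alpha};x)f(q^{\mu+\beta};x)}\le1 \qquad(\mathrm{A})$$ and $$f_0f_1(1-q^{\alpha})(1-q^{\beta})\frac{q^{\mu}x}{1-q}\le\Delta_f(\alpha,\beta;x)<\left[1-\frac{\Gamma_q(\mu+\alpha)\Gamma_q(\mu+\beta)}{\Gamma_q(\mu)\Gamma_q(\mu+\alpha+\beta)}\right]f(q^{\mu+\alpha};x)f(q^{\mu+\beta};x), \qquad(\mathrm{B})$$ with equality only at $x=0$. The lower bound in (A) and the upper bound in (B) remain valid if $\{f_n\}_{n\ge0}$ is any non-negative sequence.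
   Context: For $0<q<1$: $(a;q)_0=1$, $(a;q)_n=\prod_{k=0}^{n-1}(1-aq^k)$ for $n\ge1$, $(a;q)_\infty=\lim_{n\to\infty}(a;q)_n$, and the $q$-gamma function is $\Gamma_q(z)=(1-q)^{1-z}\dfrac{(q;q)_\infty}{(q^z;q)_\infty}$; $1/\Gamma_q(0)$ is understood as $0$. The radius $R_f$ is the same for all $a\in(0,1)$. A sequence $\{f_n\}_{n\ge0}$ of nonnegative reals is doubly positive if it is nontrivial (not identically zero), is log-concave ($f_k^2\ge f_{k-1}f_{k+1}$ for all $k\ge1$), and has no internal zeros ($f_N=0$ implies that either $f_{N+i}=0$ for all $i\ge0$, or $f_{N-i}=0$ for $i=0,\dots,N$).
   Formalization: Strict bounds are claimed only if f_0≠0 or (μ>0 and x>0), as otherwise they read 0<0, D<D or 0/0; "equality only at x=0" is claimed only if some f_n≠0 with n≥1, as f=(f_0,0,0,…) gives equality for all x; the zero sequence is excluded from the last sentence. *)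

theory Defs
  imports "HOL-Analysis.Analysis"
begin

definition qpoch :: "real \<Rightarrow> real \<Rightarrow> nat \<Rightarrow> real" where
  "qpoch a q n = (\<Prod>k<n. 1 - a * q ^ k)"

definition qpoch_inf :: "real \<Rightarrow> real \<Rightarrow> real" where
  "qpoch_inf a q = lim (\<lambda>n. qpoch a q n)"

text \<open>
  For \<open>0 < q < 1\<close> the denominator vanishes at \<open>z = 0\<close>, so \<open>qGamma q 0 = 0\<close> and
  \<open>1 / qGamma q 0 = 0\<close>: totalised division gives the usual convention for the
  reciprocal of the q-gamma function at its pole (see \<open>inverse_qGamma_0\<close> below).
\<close>

definition qGamma :: "real \<Rightarrow> real \<Rightarrow> real" where
  "qGamma q z = (1 - q) powr (1 - z) * (qpoch_inf q q / qpoch_inf (q powr z) q)"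

definition qcoeff :: "real \<Rightarrow> (nat \<Rightarrow> real) \<Rightarrow> real \<Rightarrow> nat \<Rightarrow> real" where
  "qcoeff q f a n = f n * (qpoch a q n / qpoch q q n)"

definition qseries :: "real \<Rightarrow> (nat \<Rightarrow> real) \<Rightarrow> real \<Rightarrow> real \<Rightarrow> real" where
  "qseries q f a x = (\<Sum>n. qcoeff q f a n * x ^ n)"

text \<open>
  The common radius of convergence of the series over all parameters \<open>0 < a < 1\<close>; that it
  does not depend on \<open>a\<close> is \<open>conv_radius_qcoeff\<close> below.  The endpoint \<open>a = 1\<close>
  has to be left out, since there the series reduces to its constant term.
\<close>

definition qradius :: "real \<Rightarrow> (nat \<Rightarrow> real) \<Rightarrow> ereal" where
  "qradius q f = (THE R. \<forall>a. 0 < a \<and> a < 1 \<longrightarrow> conv_radius (qcoeff q f a) = R)"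

definition qDelta ::
  "real \<Rightarrow> (nat \<Rightarrow> real) \<Rightarrow> real \<Rightarrow> real \<Rightarrow> real \<Rightarrow> real \<Rightarrow> real" where
  "qDelta q f \<mu> \<alpha> \<beta> x =
     qseries q f (q powr (\<mu> + \<alpha>)) x * qseries q f (q powr (\<mu> + \<beta>)) x
     - qseries q f (q powr \<mu>) x * qseries q f (q powr (\<mu> + \<alpha> + \<beta>)) x"

definition doubly_positive :: "(nat \<Rightarrow> real) \<Rightarrow> bool" where
  "doubly_positive f \<longleftrightarrow>
     (\<forall>n. 0 \<le> f n) \<and> (\<exists>n. f n \<noteq> 0) \<and>
     (\<forall>k\<ge>1. (f k)\<^sup>2 \<ge> f (k - 1) * f (k + 1)) \<and>
     (\<forall>N. f N = 0 \<longrightarrow> (\<forall>i. f (N + i) = 0) \<or> (\<forall>i\<le>N. f (N - i) = 0))"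

lemma inverse_qGamma_0:
  assumes "0 < q" "q < 1"
  shows "1 / qGamma q 0 = 0"
proof -
  have "qpoch 1 q n = 0" if "n \<ge> 1" for n
    unfolding qpoch_def using that by (intro prod_zero) (auto intro!: bexI[of _ 0])
  then have "eventually (\<lambda>n. qpoch 1 q n = 0) sequentially"
    by (auto simp: eventually_sequentially)
  then have "(\<lambda>n. qpoch 1 q n) \<longlonglongrightarrow> 0"
    by (rule tendsto_eventually)
  then have "qpoch_inf 1 q = 0"
    unfolding qpoch_inf_def by (rule limI)
  then show ?thesis
    using assms by (simp add: qGamma_def)
qed

lemma qpoch_nz_limit:
  assumes q: "0 < q" "q < 1" and a: "0 < a" "a < 1"
  shows "\<exists>L. L \<noteq> 0 \<and> qpoch a q \<longlonglongrightarrow> L"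
proof -
  have lt: "a * q ^ k < 1" for k
  proof -
    have "q ^ k \<le> 1"
      using q by (intro power_le_one) auto
    then have "a * q ^ k \<le> a * 1"
      using a by (intro mult_left_mono) auto
    then show ?thesis using a by linarith
  qed
  have "summable (\<lambda>k. a * q ^ k)"
    using q by (intro summable_mult summable_geometric) auto
  then have "summable (\<lambda>k. norm ((1 - a * q ^ k) - 1))"
    using q a by (simp add: abs_mult)
  then have cp: "convergent_prod (\<lambda>k. 1 - a * q ^ k)"
    by (intro abs_convergent_prod_imp_convergent_prod summable_imp_abs_convergent_prod)
  have nz: "1 - a * q ^ k \<noteq> 0" for k
    using lt[of k] by simp
  show ?thesis
    using cp unfolding convergent_prod_iff_nz_lim[of "\<lambda>k. 1 - a * q ^ k", OF nz]
    by (auto simp: qpoch_def[abs_def] LIMSEQ_lessThan_iff_atMost[of "prod (\<lambda>k. 1 - a * q ^ k)"])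
qed

lemma qpoch_nz:
  assumes "0 < q" "q < 1" "0 < a" "a < 1"
  shows "qpoch a q n \<noteq> 0"
proof -
  have "a * q ^ k \<noteq> 1" for k
  proof -
    have "q ^ k \<le> 1"
      using assms by (intro power_le_one) auto
    then have "a * q ^ k \<le> a * 1"
      using assms by (intro mult_left_mono) auto
    then show ?thesis using assms by linarith
  qed
  then show ?thesis
    by (simp add: qpoch_def)
qed

lemma Bseq_qpoch_quotient:
  assumes q: "0 < q" "q < 1" and a: "0 < a" "a < 1" and b: "0 < b" "b < 1"
  shows "Bseq (\<lambda>n. qpoch a q n / qpoch b q n)"
proof -
  obtain L where "qpoch a q \<longlonglongrightarrow> L"
    using qpoch_nz_limit[OF q a] by blast
  moreover obtain M where "M \<noteq> 0" "qpoch b q \<longlonglongrightarrow> M"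
    using qpoch_nz_limit[OF q b] by blast
  ultimately have "(\<lambda>n. qpoch a q n / qpoch b q n) \<longlonglongrightarrow> L / M"
    by (intro tendsto_divide)
  then show ?thesis
    by (intro convergent_imp_Bseq) (auto simp: convergent_def)
qed

lemma conv_radius_mult_Bseq:
  fixes f d :: "nat \<Rightarrow> real"
  assumes "Bseq d"
  shows "conv_radius f \<le> conv_radius (\<lambda>n. f n * d n)"
proof (rule conv_radius_geI_ex')
  fix r :: real
  assume r: "0 < r" "ereal r < conv_radius f"
  obtain K where K: "\<And>n. norm (d n) \<le> K"
    using assms by (auto simp: Bseq_def)
  have "summable (\<lambda>n. norm (f n * r ^ n))"
    using r by (intro abs_summable_in_conv_radius) auto
  then have S: "summable (\<lambda>n. K * norm (f n * r ^ n))"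
    by (rule summable_mult)
  have "norm (f n * d n * r ^ n) \<le> K * norm (f n * r ^ n)" for n
    using mult_right_mono[OF K[of n], of "norm (f n * r ^ n)"]
    by (simp add: abs_mult mult_ac)
  then show "summable (\<lambda>n. f n * d n * of_real r ^ n)"
    by (intro summable_comparison_test'[OF S]) simp
qed

lemma conv_radius_qcoeff:
  assumes q: "0 < q" "q < 1" and a: "0 < a" "a < 1"
  shows "conv_radius (qcoeff q f a) = conv_radius f"
proof (rule antisym)
  have eq: "(\<lambda>n. qcoeff q f a n * (qpoch q q n / qpoch a q n)) = f"
    by (simp add: qcoeff_def fun_eq_iff qpoch_nz q a)
  show "conv_radius (qcoeff q f a) \<le> conv_radius f"
    using conv_radius_mult_Bseq[OF Bseq_qpoch_quotient[OF q q a], of "qcoeff q f a"]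
    unfolding eq .
  show "conv_radius f \<le> conv_radius (qcoeff q f a)"
    using conv_radius_mult_Bseq[OF Bseq_qpoch_quotient[OF q a q], of f]
    unfolding qcoeff_def[abs_def] .
qed

lemma qradius_eq:
  assumes q: "0 < q" "q < 1"
  shows "qradius q f = conv_radius f"
  unfolding qradius_def
proof (rule the_equality)
  show "\<forall>a. 0 < a \<and> a < 1 \<longrightarrow> conv_radius (qcoeff q f a) = conv_radius f"
    by (simp add: conv_radius_qcoeff q)
next
  fix R :: ereal
  assume "\<forall>a. 0 < a \<and> a < 1 \<longrightarrow> conv_radius (qcoeff q f a) = R"
  then have "conv_radius (qcoeff q f q) = R" using q by blast
  then show "R = conv_radius f" by (simp add: conv_radius_qcoeff q)
qed

end

theory Submission
  imports Defs "HOL-Computational_Algebra.Formal_Power_Series"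
begin

text \<open>
  Put \<open>a = q^\<mu>\<close>, \<open>b = q^(\<mu>+\<alpha>)\<close>, \<open>c = q^(\<mu>+\<beta>)\<close>, \<open>d = q^(\<mu>+\<alpha>+\<beta>)\<close>, so \<open>ad = bc\<close> and \<open>b + c < a + d\<close>.

  Upper bound for \<open>\<Delta>\<close>: since \<open>(a;q)_n = (a;q)_\<infinity> / (aq^n;q)_\<infinity>\<close> and \<open>1/(q^\<mu>;q)_\<infinity>\<close> is log-convex in \<open>\<mu>\<close>,
  so is \<open>f(q^\<mu>;x) / (q^\<mu>;q)_\<infinity>\<close>, by Hoelder's inequality; the ratio of q-gamma functions is
  \<open>(a;q)_\<infinity> (d;q)_\<infinity> / ((b;q)_\<infinity> (c;q)_\<infinity>)\<close>.

  Lower bound: the coefficient of \<open>x^m\<close> in \<open>\<Delta>\<close> is \<open>\<Sum>k\<le>m. f_k f_(m-k) M_k\<close>. Log-concavity makes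
  \<open>f_k f_(m-k)\<close> increase for \<open>k \<le> m/2\<close>, the symmetrized \<open>M_k\<close> changes sign at most once there, from
  minus to plus, and \<open>\<Sum>k. M_k \<ge> 0\<close>; hence every coefficient is nonnegative. The coefficient of
  \<open>x\<close> is the claimed lower bound, and some later coefficient is positive.
\<close>

section \<open>Finite q-shifted factorials\<close>

lemma qpoch_0 [simp]: "qpoch a q 0 = 1"
  by (simp add: qpoch_def)

lemma qpoch_Suc: "qpoch a q (Suc n) = qpoch a q n * (1 - a * q ^ n)"
  by (simp add: qpoch_def)

lemma qpoch_add: "qpoch a q (m + n) = qpoch a q m * qpoch (a * q ^ m) q n"
  by (induction n) (simp_all add: qpoch_Suc power_add mult_ac)

lemma qpoch_pos:
  assumes "0 < q" "q < 1" "0 \<le> a" "a < 1"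
  shows "0 < qpoch a q n"
  unfolding qpoch_def
proof (intro prod_pos ballI)
  fix k
  have "a * q ^ k \<le> a * 1"
    using assms by (intro mult_left_mono power_le_one) auto
  then show "0 < 1 - a * q ^ k" using assms by simp
qed

lemma qpoch_mono:
  assumes "0 < q" "q < 1" "0 \<le> a" "a \<le> b" "b \<le> 1"
  shows "qpoch b q n \<le> qpoch a q n"
  unfolding qpoch_def
proof (intro prod_mono conjI)
  fix k
  have "b * q ^ k \<le> b * 1"
    using assms by (intro mult_left_mono power_le_one) auto
  then show "0 \<le> 1 - b * q ^ k" using assms by simp
  show "1 - b * q ^ k \<le> 1 - a * q ^ k"
    using assms by (simp add: mult_right_mono)
qed

lemma qpoch_one: "qpoch 1 q n = (if n = 0 then 1 else 0)"
  by (auto simp: qpoch_def intro!: bexI[of _ 0])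

lemma qpoch_nonneg:
  assumes "0 < q" "q < 1" "0 \<le> a" "a \<le> 1"
  shows "0 \<le> qpoch a q n"
  using qpoch_pos[OF assms(1-3), of n] qpoch_one[of q n] assms(4) by (cases "a = 1") auto

subsection \<open>The case of a constant sequence\<close>

text \<open>By the q-binomial theorem this is \<open>(aX;q)_\<infinity> / (X;q)_\<infinity>\<close>;
  taken as a formal power series, it raises no question of convergence.\<close>

definition qbin :: "real \<Rightarrow> real \<Rightarrow> real fps" where
  "qbin q a = Abs_fps (\<lambda>n. qpoch a q n / qpoch q q n)"

text \<open>The substitution of \<open>qX\<close> for \<open>X\<close>.\<close>

definition fps_dilate :: "real \<Rightarrow> real fps \<Rightarrow> real fps" where
  "fps_dilate q F = Abs_fps (\<lambda>n. q ^ n * fps_nth F n)"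

definition fps_nonneg :: "real fps \<Rightarrow> bool" where
  "fps_nonneg F \<longleftrightarrow> (\<forall>n. 0 \<le> fps_nth F n)"

lemma fps_nonneg_mult: "fps_nonneg F \<Longrightarrow> fps_nonneg G \<Longrightarrow> fps_nonneg (F * G)"
  by (auto simp: fps_nonneg_def fps_mult_nth intro!: sum_nonneg)

lemma fps_dilate_mult: "fps_dilate q (F * G) = fps_dilate q F * fps_dilate q G"
  by (auto simp: fps_dilate_def fps_eq_iff fps_mult_nth sum_distrib_left
      simp flip: power_add intro!: sum.cong)

lemma fps_dilate_diff: "fps_dilate q (F - G) = fps_dilate q F - fps_dilate q G"
  by (simp add: fps_dilate_def fps_eq_iff right_diff_distrib)

lemma fps_nonneg_dilate: "0 \<le> q \<Longrightarrow> fps_nonneg F \<Longrightarrow> fps_nonneg (fps_dilate q F)"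
  by (simp add: fps_nonneg_def fps_dilate_def)

text \<open>Comparing coefficients, this is the recursion
  \<open>(1 - q^(m+1)) t_(m+1) = (1 - a q^m) t_m\<close> for the coefficients \<open>t_m\<close> of
  \<open>qbin q a\<close>.\<close>

lemma qbin_dilate:
  assumes "0 < q" "q < 1"
  shows "(1 - fps_X) * qbin q a = (1 - fps_const a * fps_X) * fps_dilate q (qbin q a)"
proof (rule fps_ext)
  fix n
  show "fps_nth ((1 - fps_X) * qbin q a) n
    = fps_nth ((1 - fps_const a * fps_X) * fps_dilate q (qbin q a)) n"
  proof (cases n)
    case 0
    then show ?thesis by (simp add: fps_dilate_def)
  next
    case (Suc m)
    have pos: "0 < qpoch q q m" "0 < qpoch q q (Suc m)"
      using assms by (simp_all add: qpoch_pos)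
    then have nz: "1 - q * q ^ m \<noteq> 0"
      by (auto simp: qpoch_Suc)
    have "(1 - q ^ Suc m) * (qpoch a q (Suc m) / qpoch q q (Suc m))
        = (1 - a * q ^ m) * (qpoch a q m / qpoch q q m)"
      using pos nz by (simp add: qpoch_Suc)
    then show ?thesis
      by (simp add: Suc fps_dilate_def qbin_def algebra_simps diff_divide_distrib)
  qed
qed

text \<open>
  Writing \<open>D\<close> for the difference, the functional equation gives \<open>D(X) = H(X) D(qX) + G(X)\<close> with
  \<open>H = (1 - aX)(1 - dX)/(1 - X)^2\<close> and \<open>G\<close> having nonnegative coefficients and \<open>H(0) = 1\<close>, so that
  \<open>(1 - q^n) D_n\<close> is a nonnegative combination of the earlier coefficients plus \<open>G_n\<close>.
\<close>

lemma qbin_mult_coeff_nonneg: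
  assumes q: "0 < q" "q < 1"
    and abcd: "0 \<le> a" "a \<le> 1" "0 \<le> b" "b \<le> 1" "0 \<le> c" "c \<le> 1" "0 \<le> d" "d \<le> 1"
    and prod: "a * d = b * c" and sum: "b + c \<le> a + d"
  shows "fps_nonneg (qbin q b * qbin q c - qbin q a * qbin q d)"
proof -
  define D where "D = qbin q b * qbin q c - qbin q a * qbin q d"
  define J :: "real fps" where "J = Abs_fps (\<lambda>_. 1)"
  define L where "L t = 1 - fps_const t * fps_X" for t :: real
  define G where "G = J * J * (fps_const (a + d - b - c) * fps_X *
    fps_dilate q (qbin q b * qbin q c))"
  define H where "H = (L a * J) * (L d * J)"
  have J: "(1 - fps_X) * J = 1"
    by (auto simp: fps_eq_iff J_def algebra_simps)
  \<comment> \<open>\<open>J\<close> is \<open>1/(1 - X)\<close>, and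
    \<open>(1 - tX)/(1 - X) = 1 + (1 - t)(X + X^2 + ...)\<close> has nonnegative coefficients for
    \<open>t \<le> 1\<close>; this gives \<open>nnH\<close>.\<close>
  have LJ: "fps_nth (L t * J) n = (if n = 0 then 1 else 1 - t)" for t n
    by (cases n) (simp_all add: L_def J_def algebra_simps)
  \<comment> \<open>Because \<open>ad = bc\<close>, the two quadratics differ only in their linear
    terms; this difference produces \<open>G\<close>.\<close>
  have LL: "L b * L c = L a * L d + fps_const (a + d - b - c) * fps_X"
  proof -
    have "fps_const b * fps_const c = fps_const a * fps_const d"
      using prod by simp
    moreover have "fps_const (a + d - b - c) = fps_const a + fps_const d - fps_const b - fps_const c"
      by simp
    ultimately show ?thesis unfolding L_def by algebra
  qed
  have nnq: "fps_nonneg (qbin q t)" if "0 \<le> t" "t \<le> 1" for t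
    using that q by (auto simp: fps_nonneg_def qbin_def qpoch_nonneg)
  have nnJ: "fps_nonneg J"
    by (simp add: J_def fps_nonneg_def)
  have nnX: "fps_nonneg (fps_const (a + d - b - c) * fps_X)"
    using sum by (simp add: fps_nonneg_def)
  have nnG: "fps_nonneg G"
    unfolding G_def using q abcd
    by (intro fps_nonneg_mult[OF fps_nonneg_mult[OF nnJ nnJ]] fps_nonneg_mult[OF nnX]
        fps_nonneg_dilate fps_nonneg_mult nnq) auto
  have nnH: "fps_nonneg H"
    unfolding H_def
    by (rule fps_nonneg_mult) (use abcd in \<open>simp_all add: fps_nonneg_def LJ\<close>)
  have H0: "fps_nth H 0 = 1"
    unfolding H_def fps_mult_nth_0[of "L a * J"] LJ by simp
  have fe: "(1 - fps_X) * qbin q t = L t * fps_dilate q (qbin q t)" for t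
    unfolding L_def by (rule qbin_dilate[OF q])
  \<comment> \<open>Multiplying by \<open>(1 - X)^2\<close> makes \<open>fe\<close> applicable to
    each factor, and \<open>J * J\<close> undoes it.\<close>
  have "D = (J * J) * (((1 - fps_X) * qbin q b) * ((1 - fps_X) * qbin q c) -
         ((1 - fps_X) * qbin q a) * ((1 - fps_X) * qbin q d))"
    using J unfolding D_def by algebra
  also have "\<dots> = (J * J) * (L b * L c * fps_dilate q (qbin q b * qbin q c)
     - L a * L d * fps_dilate q (qbin q a * qbin q d))"
    unfolding fe fps_dilate_mult by (simp add: mult_ac)
  also have "\<dots> = fps_dilate q D * H + G"
    unfolding LL D_def H_def G_def fps_dilate_diff by (simp add: algebra_simps)
  finally have D: "D = fps_dilate q D * H + G" .
  have "0 \<le> fps_nth D n" for n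
  proof (induction n rule: less_induct)
    case (less n)
    show ?case
    proof (cases "n = 0")
      case True
      then show ?thesis by (simp add: D_def qbin_def)
    next
      case False
      have "fps_nth D n = (\<Sum>i=0..n. q ^ i * fps_nth D i * fps_nth H (n - i)) + fps_nth G n"
        by (subst D) (simp add: fps_mult_nth fps_dilate_def)
      also have "(\<Sum>i=0..n. q ^ i * fps_nth D i * fps_nth H (n - i)) =
          (\<Sum>i<n. q ^ i * fps_nth D i * fps_nth H (n - i)) + q ^ n * fps_nth D n"
        by (simp add: atLeast0AtMost lessThan_Suc_atMost[symmetric] H0)
      finally have "(1 - q ^ n) * fps_nth D n = (\<Sum>i<n. q ^ i * fps_nth D i * fps_nth H (n - i)) + fps_nth G n"
        by (simp add: algebra_simps)
      also have "0 \<le> (\<Sum>i<n. q ^ i * fps_nth D i * fps_nth H (n - i)) + fps_nth G n"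
        using less nnH nnG q
        by (intro add_nonneg_nonneg sum_nonneg mult_nonneg_nonneg) (auto simp: fps_nonneg_def)
      finally have "0 \<le> (1 - q ^ n) * fps_nth D n" .
      moreover have "q ^ n < 1"
        using q False by (simp add: power_less_one_iff)
      ultimately show ?thesis
        by (simp add: zero_le_mult_iff)
    qed
  qed
  then show ?thesis
    by (simp add: fps_nonneg_def D_def)
qed

subsection \<open>Single sign change of the symmetrized coefficients\<close>

text \<open>Log-concavity makes the quotients \<open>f (k+1) / f k\<close> decrease; the
  cross-multiplied form admits zeros. The induction step divides by \<open>f l\<close>; if
  \<open>f l = 0\<close>, the absence of internal zeros makes \<open>f k\<close> or
  \<open>f (l+2)\<close> vanish.\<close>

lemma log_concave_crossing:
  fixes f :: "nat \<Rightarrow> real"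
  assumes f: "doubly_positive f" and "k \<le> l"
  shows "f k * f (Suc l) \<le> f (Suc k) * f l"
  using \<open>k \<le> l\<close>
proof (induction l rule: dec_induct)
  case base
  then show ?case by simp
next
  case (step l)
  have nn: "0 \<le> f n" for n
    using f by (simp add: doubly_positive_def)
  have lc: "f l * f (Suc (Suc l)) \<le> (f (Suc l))\<^sup>2"
    using f by (force simp: doubly_positive_def dest: spec[of _ "Suc l"])
  show ?case
  proof (cases "f l = 0")
    case True
    then have "(\<forall>i. f (l + i) = 0) \<or> (\<forall>i\<le>l. f (l - i) = 0)"
      using f by (simp add: doubly_positive_def)
    then have "f (Suc (Suc l)) = 0 \<or> f k = 0"
    proof
      assume "\<forall>i. f (l + i) = 0"
      from spec[OF this, of 2] show ?thesis by simp
    next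
      assume "\<forall>i\<le>l. f (l - i) = 0"
      from spec[OF this, of "l - k"] show ?thesis using step by simp
    qed
    then show ?thesis using nn by auto
  next
    case False
    then have pos: "0 < f l" using nn[of l] by simp
    have "f l * (f k * f (Suc (Suc l))) \<le> f k * (f (Suc l))\<^sup>2"
      using mult_left_mono[OF lc nn[of k]] by (simp add: mult_ac)
    also have "\<dots> \<le> f l * (f (Suc k) * f (Suc l))"
      using mult_right_mono[OF step.IH nn[of "Suc l"]] by (simp add: power2_eq_square mult_ac)
    finally show ?thesis using pos by simp
  qed
qed

text \<open>Each step towards the middle is \<open>log_concave_crossing\<close> with
  \<open>l = m - Suc k\<close>; the bound \<open>2 * Suc k \<le> m\<close> ensures
  \<open>k \<le> l\<close>.\<close>

lemma log_concave_pair_mono: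
  fixes f :: "nat \<Rightarrow> real"
  assumes f: "doubly_positive f" and "j \<le> k" "2 * k \<le> m"
  shows "f j * f (m - j) \<le> f k * f (m - k)"
  using assms(2,3)
proof (induction k rule: dec_induct)
  case (step k)
  have "f k * f (m - k) \<le> f (Suc k) * f (m - Suc k)"
    using log_concave_crossing[OF f, of k "m - Suc k"] step by (simp add: Suc_diff_Suc)
  then show ?case using step by simp
qed simp

text \<open>
  After division by \<open>(1 - a)(1 - d)\<close> and \<open>(1 - b)(1 - c)\<close> this compares two weighted means; spreading
  the pair \<open>(b, c)\<close> to \<open>(a, d)\<close> raises the sum of the averaged values, raises the larger of them, and
  moves weight to it. The cross-multiplied form also covers \<open>a = 1\<close>.
\<close>

lemma spread_ratio:
  fixes a b c d Q wa wb wc wd :: real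
  assumes ord: "0 \<le> d" "d \<le> c" "c \<le> b" "b \<le> a" "a \<le> 1" and prod: "a * d = b * c"
    and Q: "0 \<le> Q" "Q \<le> 1"
    and w: "0 \<le> wa" "wa \<le> wb" "wb \<le> wc" "wc \<le> wd"
  shows "((1 - b * Q) * (1 - b) * wb + (1 - c * Q) * (1 - c) * wc) * ((1 - a) * (1 - d) * (wa + wd))
    \<le> ((1 - a * Q) * (1 - a) * wa + (1 - d * Q) * (1 - d) * wd) * ((1 - b) * (1 - c) * (wb + wc))"
proof -
  \<comment> \<open>\<open>X1\<close> and \<open>Y1\<close> over \<open>D1\<close> are the values
    averaged with weights \<open>wa\<close>, \<open>wd\<close>; \<open>X2\<close> and
    \<open>Y2\<close> over \<open>D2\<close> those averaged with \<open>wb\<close>,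
    \<open>wc\<close>. Below, \<open>A\<close> compares the sums of the values, \<open>B\<close> the
    larger values and \<open>E\<close> the weights.\<close>
  define X1 Y1 X2 Y2 where XY: "X1 = (1 - a * Q) * (1 - a)" "Y1 = (1 - d * Q) * (1 - d)"
    "X2 = (1 - b * Q) * (1 - b)" "Y2 = (1 - c * Q) * (1 - c)"
  define D1 D2 where D: "D1 = (1 - a) * (1 - d)" "D2 = (1 - b) * (1 - c)"
  define s1 s2 p where sp: "s1 = a + d" "s2 = b + c" "p = a * d"
  have le1: "t * Q \<le> 1" if "0 \<le> t" "t \<le> 1" for t
    using mult_le_one[OF that(2) Q] by simp
  have D0: "0 \<le> D1" "0 \<le> D2"
    using ord by (auto simp: D)
  have s: "s2 \<le> s1"
  proof -
    have "0 \<le> (a - b) * (a - c)" using ord by auto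
    also have "\<dots> = a * (s1 - s2)" unfolding sp using prod by algebra
    finally show ?thesis using ord sp by (auto simp: zero_le_mult_iff)
  qed
  \<comment> \<open>These bounds fix the sign of every bracket in the factorization that proves
    \<open>A\<close>.\<close>
  have range: "2 * p \<le> u + v" "u + v \<le> 2" if "u * v = p" "0 \<le> u" "u \<le> 1" "0 \<le> v" "v \<le> 1" for u v
  proof -
    have "u * v \<le> u * 1" "u * v \<le> 1 * v" using that by (intro mult_mono; simp)+
    then show "2 * p \<le> u + v" using that by simp
    show "u + v \<le> 2" using that by simp
  qed
  have r1: "2 * p \<le> s1" "s1 \<le> 2" using range[of a d] ord sp by auto
  have r2: "2 * p \<le> s2" "s2 \<le> 2" using range[of b c] ord sp prod by auto
  have p1: "p \<le> 1" using r1 by simp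
  have "2 * ((X1 + Y1) * D2 - (X2 + Y2) * D1)
    = (s1 - s2) * (2 * (1 - Q) * (1 - p) + Q * ((2 - s1) * (s2 - 2 * p) + (2 - s2) * (s1 - 2 * p)))"
    unfolding XY D sp using prod by algebra
  also have "0 \<le> \<dots>"
    using s r1 r2 p1 Q by (intro mult_nonneg_nonneg add_nonneg_nonneg) auto
  finally have A: "0 \<le> (X1 + Y1) * D2 - (X2 + Y2) * D1" by simp
  have B: "0 \<le> Y1 * D2 - Y2 * D1"
  proof -
    have "d * Q \<le> c * Q" using ord Q by (simp add: mult_right_mono)
    moreover have "c * Q \<le> 1" using le1 ord by simp
    ultimately have "(1 - c * Q) * (1 - a) \<le> (1 - d * Q) * (1 - b)"
      using ord by (intro mult_mono) auto
    then have "0 \<le> ((1 - c) * (1 - d)) * ((1 - d * Q) * (1 - b) - (1 - c * Q) * (1 - a))"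
      using ord by simp
    then show ?thesis unfolding XY D by (simp add: algebra_simps)
  qed
  have C: "X1 \<le> Y1"
  proof -
    have "d * Q \<le> a * Q" using ord Q by (simp add: mult_right_mono)
    then show ?thesis unfolding XY using ord le1[of a] by (intro mult_mono) auto
  qed
  have E: "wa * wc \<le> wd * wb"
    using w mult_mono[of wa wb wc wd] by (simp add: mult.commute)
  \<comment> \<open>The first term accounts for the shift of weight. The second compares the values
    under the weights \<open>wb\<close>, \<open>wc\<close>, with \<open>wb X + wc Y\<close> written
    as \<open>wb (X + Y) + (wc - wb) Y\<close>.\<close>
  have "(X1 * wa + Y1 * wd) * (D2 * (wb + wc)) - (X2 * wb + Y2 * wc) * (D1 * (wa + wd))
    = D2 * ((Y1 - X1) * (wd * wb - wa * wc))
      + (wa + wd) * (wb * ((X1 + Y1) * D2 - (X2 + Y2) * D1) + (wc - wb) * (Y1 * D2 - Y2 * D1))"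
    by algebra
  also have "0 \<le> \<dots>"
    using A B C D0 E w by (intro add_nonneg_nonneg mult_nonneg_nonneg) auto
  finally show ?thesis unfolding XY D by (simp add: mult.assoc)
qed

text \<open>Numerator of the coefficient of \<open>f k * f l\<close> symmetrized in \<open>k\<close>
  and \<open>l\<close>, for one of the pairs \<open>(a, d)\<close> and
  \<open>(b, c)\<close>.\<close>

definition qpair :: "real \<Rightarrow> real \<Rightarrow> real \<Rightarrow> nat \<Rightarrow> nat \<Rightarrow> real" where
  "qpair q a d k l = qpoch a q k * qpoch d q l + qpoch d q k * qpoch a q l"

text \<open>Once \<open>(u;q)_k (v;q)_k\<close> is factored out, the quotient of
  \<open>qpair\<close> at \<open>(k, l+1)\<close> by \<open>qpair\<close> at \<open>(k+1, l)\<close>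
  is a weighted mean as in \<open>spread_ratio\<close>, with parameters scaled by
  \<open>q^k\<close>. Spreading \<open>(b, c)\<close> to \<open>(a, d)\<close> raises it, so
  dominance of \<open>(b, c)\<close> passes to the next pair of indices.\<close>

lemma qpair_single_crossing:
  assumes q: "0 < q" "q < 1"
    and ord: "0 \<le> d" "d \<le> c" "c \<le> b" "b \<le> a" "a \<le> 1" "b < 1" and prod: "a * d = b * c"
    and kl: "Suc k \<le> l" and le: "qpair q a d k (Suc l) \<le> qpair q b c k (Suc l)"
  shows "qpair q a d (Suc k) l \<le> qpair q b c (Suc k) l"
proof -
  obtain r where l: "l = Suc k + r"
    using kl le_Suc_ex by blast
  \<comment> \<open>Since \<open>l = k + 1 + r\<close>, the last factor \<open>1 - u q^l\<close> of
    \<open>(u;q)_(l+1)\<close> is \<open>1 - (u q^k) Q\<close>; \<open>w u\<close> collects the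
    factors with exponents \<open>k + 1\<close> to \<open>l - 1\<close> and decreases in
    \<open>u\<close>.\<close>
  define Q where "Q = q ^ Suc r"
  define w where "w t = qpoch (t * q ^ Suc k) q r" for t
  define P where "P u v = qpoch u q k * qpoch v q k" for u v
  have upper: "qpair q u v k (Suc l) = P u v * ((1 - (u * q ^ k) * Q) * (1 - u * q ^ k) * w u
      + (1 - (v * q ^ k) * Q) * (1 - v * q ^ k) * w v)" for u v
    unfolding qpair_def l qpoch_Suc[of _ _ "Suc k + r"] qpoch_add[of _ _ "Suc k"] qpoch_Suc[of _ _ k]
      P_def Q_def w_def
    by (simp add: power_add algebra_simps)
  have lower: "qpair q u v (Suc k) l = P u v * ((1 - u * q ^ k) * (1 - v * q ^ k) * (w u + w v))" for u v
    unfolding qpair_def l qpoch_add[of _ _ "Suc k"] qpoch_Suc[of _ _ k] P_def w_def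
    by (simp add: algebra_simps)
  have sc: "0 \<le> t * q ^ j" "t * q ^ j \<le> 1" if "0 \<le> t" "t \<le> 1" for t j
    using that q mult_le_one[of t "q ^ j"] by (auto simp: power_le_one)
  have w: "w t \<le> w s" if "0 \<le> s" "s \<le> t" "t \<le> 1" for s t
    unfolding w_def using that q sc[of s] sc[of t "Suc k"]
    by (intro qpoch_mono mult_right_mono) auto
  have w0: "0 \<le> w a"
    unfolding w_def using sc[of a "Suc k"] ord q by (intro qpoch_nonneg) auto
  have P0: "0 \<le> P a d" "0 \<le> P b c"
    unfolding P_def using ord q by (auto intro!: mult_nonneg_nonneg qpoch_nonneg)
  have "qpair q b c k (Suc l) * qpair q a d (Suc k) l \<le> qpair q a d k (Suc l) * qpair q b c (Suc k) l"
  proof -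
    have "((1 - (b * q ^ k) * Q) * (1 - b * q ^ k) * w b + (1 - (c * q ^ k) * Q) * (1 - c * q ^ k) * w c)
        * ((1 - a * q ^ k) * (1 - d * q ^ k) * (w a + w d))
      \<le> ((1 - (a * q ^ k) * Q) * (1 - a * q ^ k) * w a + (1 - (d * q ^ k) * Q) * (1 - d * q ^ k) * w d)
        * ((1 - b * q ^ k) * (1 - c * q ^ k) * (w b + w c))"
    proof (rule spread_ratio)
      show "a * q ^ k * (d * q ^ k) = b * q ^ k * (c * q ^ k)"
        using arg_cong[OF prod, of "\<lambda>z. z * (q ^ k * q ^ k)"] by (simp only: mult_ac)
      show "0 \<le> Q" "Q \<le> 1"
        unfolding Q_def using q power_le_one[of q "Suc r"] by auto
    qed (use ord q sc[of a k] w0 in \<open>auto intro!: w mult_right_mono\<close>)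
    from mult_left_mono[OF this, of "P a d * P b c"] show ?thesis
      unfolding upper lower using P0 by (simp only: mult_ac mult_nonneg_nonneg)
  qed
  also have "\<dots> \<le> qpair q b c k (Suc l) * qpair q b c (Suc k) l"
    using le ord q by (intro mult_right_mono) (auto simp: qpair_def intro!: add_nonneg_nonneg mult_nonneg_nonneg qpoch_nonneg)
  finally show ?thesis
  proof (rule mult_left_le_imp_le)
    show "0 < qpair q b c k (Suc l)"
      unfolding qpair_def using ord q by (intro add_pos_pos mult_pos_pos qpoch_pos) auto
  qed
qed

text \<open>If \<open>S\<close> turns nonnegative at \<open>K\<close>, then \<open>(u k - u K) * S k \<ge> 0\<close> for all \<open>k\<close>.\<close>

lemma sum_single_crossing_nonneg:
  fixes u S :: "nat \<Rightarrow> real"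
  assumes sym: "\<And>k. k \<le> m \<Longrightarrow> u (m - k) = u k" "\<And>k. k \<le> m \<Longrightarrow> S (m - k) = S k"
    and u0: "\<And>k. 0 \<le> u k"
    and mono: "\<And>j k. j \<le> k \<Longrightarrow> 2 * k \<le> m \<Longrightarrow> u j \<le> u k"
    and crossing: "\<And>k. 2 * Suc k \<le> m \<Longrightarrow> 0 \<le> S k \<Longrightarrow> 0 \<le> S (Suc k)"
    and total: "0 \<le> (\<Sum>k\<le>m. S k)"
  shows "0 \<le> (\<Sum>k\<le>m. u k * S k)"
proof -
  \<comment> \<open>One of \<open>k\<close> and \<open>m - k\<close> lies in the lower half, so a
    symmetric property need only be checked there.\<close>
  have half: "P k" if "k \<le> m" "\<And>j. 2 * j \<le> m \<Longrightarrow> P j" "\<And>j. j \<le> m \<Longrightarrow> P (m - j) = P j"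
    for P :: "nat \<Rightarrow> bool" and k
    using that(1) that(2)[of k] that(2)[of "m - k"] that(3)[of k] by linarith
  have "\<exists>k. 2 * k \<le> m \<and> 0 \<le> S k"
  proof (rule ccontr)
    assume none: "\<not> ?thesis"
    have neg: "S k < 0" if "2 * k \<le> m" for k
    proof (rule ccontr)
      assume "\<not> S k < 0"
      then have "2 * k \<le> m \<and> 0 \<le> S k" using that by simp
      then show False using none by blast
    qed
    have "S k < 0" if "k \<le> m" for k
      using half[OF that, of "\<lambda>k. S k < 0"] neg sym(2) by metis
    then have "(\<Sum>k\<le>m. S k) < (\<Sum>k\<le>m. 0)"
      by (intro sum_strict_mono) auto
    with total show False by simp
  qed
  then obtain k where k: "2 * k \<le> m \<and> 0 \<le> S k" ..
  define K where "K = (LEAST k. 2 * k \<le> m \<and> 0 \<le> S k)"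
  have K: "2 * K \<le> m" "0 \<le> S K"
    using LeastI[of "\<lambda>k. 2 * k \<le> m \<and> 0 \<le> S k", OF k] by (auto simp: K_def)
  have least: "K \<le> k" if "2 * k \<le> m" "0 \<le> S k" for k
    unfolding K_def using that by (intro Least_le) simp
  have above: "0 \<le> S k" if "K \<le> k" "2 * k \<le> m" for k
    using that by (induction k rule: dec_induct) (use K crossing in auto)
  have "0 \<le> (u k - u K) * S k" if "k \<le> m" for k
  proof (rule half[OF that, of "\<lambda>k. 0 \<le> (u k - u K) * S k"])
    fix k assume k: "2 * k \<le> m"
    show "0 \<le> (u k - u K) * S k"
    proof (cases "K \<le> k")
      case True
      then show ?thesis using above mono k by simp
    next
      case False
      then have "u k \<le> u K" "S k \<le> 0"
        using mono[of k K] K(1) least[OF k] by linarith+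
      then show ?thesis by (simp add: mult_nonpos_nonpos)
    qed
  qed (simp only: sym)
  then have "0 \<le> (\<Sum>k\<le>m. (u k - u K) * S k)"
    by (intro sum_nonneg) auto
  also have "\<dots> = (\<Sum>k\<le>m. u k * S k) - u K * (\<Sum>k\<le>m. S k)"
    by (simp add: left_diff_distrib sum_subtractf sum_distrib_left)
  finally show ?thesis
    using mult_nonneg_nonneg[OF u0[of K] total] by linarith
qed

subsection \<open>The lower bound\<close>

text \<open>Contribution of the ordered pair \<open>(k, l)\<close>: the factor of
  \<open>f k * f l * x^(k+l)\<close> in the product of the series for \<open>b\<close>,
  \<open>c\<close> minus that for \<open>a\<close>, \<open>d\<close>.\<close>

definition qcross :: "real \<Rightarrow> real \<Rightarrow> real \<Rightarrow> real \<Rightarrow> real \<Rightarrow> nat \<Rightarrow> nat \<Rightarrow> real" where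
  "qcross q a b c d k l = (qpoch b q k * qpoch c q l - qpoch a q k * qpoch d q l)
     / (qpoch q q k * qpoch q q l)"

lemma qcross_symmetrize:
  "qcross q a b c d k l + qcross q a b c d l k
     = (qpair q b c k l - qpair q a d k l) / (qpoch q q k * qpoch q q l)"
  by (simp add: qcross_def qpair_def diff_divide_distrib add_divide_distrib mult_ac)

definition qcross_coeff ::
  "real \<Rightarrow> real \<Rightarrow> real \<Rightarrow> real \<Rightarrow> real \<Rightarrow> (nat \<Rightarrow> real) \<Rightarrow> nat \<Rightarrow> real" where
  "qcross_coeff q a b c d f m = (\<Sum>k\<le>m. f k * f (m - k) * qcross q a b c d k (m - k))"

lemma sum_atMost_symmetrize:
  fixes g :: "nat \<Rightarrow> real"
  shows "2 * (\<Sum>k\<le>m. g k) = (\<Sum>k\<le>m. g k + g (m - k))"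
  using sum.nat_diff_reindex[of g "Suc m"] by (simp add: sum.distrib lessThan_Suc_atMost)

text \<open>This is the constant sequence \<open>f = 1\<close>: the sum is a coefficient of the
  series in \<open>qbin_mult_coeff_nonneg\<close>.\<close>

lemma qcross_sum_nonneg:
  assumes "0 < q" "q < 1"
    and "0 \<le> a" "a \<le> 1" "0 \<le> b" "b \<le> 1" "0 \<le> c" "c \<le> 1" "0 \<le> d" "d \<le> 1"
    and "a * d = b * c" and "b + c \<le> a + d"
  shows "0 \<le> (\<Sum>k\<le>m. qcross q a b c d k (m - k))"
proof -
  have "(\<Sum>k\<le>m. qcross q a b c d k (m - k)) =
    fps_nth (qbin q b * qbin q c - qbin q a * qbin q d) m"
    by (simp add: fps_mult_nth qbin_def qcross_def atLeast0AtMost diff_divide_distrib sum_subtractf)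
  then show ?thesis
    using qbin_mult_coeff_nonneg[OF assms] by (simp add: fps_nonneg_def)
qed

text \<open>Given \<open>ad = bc\<close>, \<open>a (a + d - b - c) = (a - b)(a - c)\<close>.\<close>

lemma spread_sum_less:
  fixes a b c d :: real
  assumes "0 < d" "d < c" "b < a" "c \<le> b" "a * d = b * c"
  shows "b + c < a + d"
proof -
  have "0 < (a - b) * (a - c)" using assms by auto
  also have "\<dots> = a * (a + d - b - c)" using assms by algebra
  finally show ?thesis using assms by (simp add: zero_less_mult_iff)
qed

lemma qcross_coeff_nonneg:
  assumes q: "0 < q" "q < 1"
    and ord: "0 < d" "d < c" "c \<le> b" "b < a" "a \<le> 1" and prod: "a * d = b * c"
    and f: "doubly_positive f"
  shows "0 \<le> qcross_coeff q a b c d f m"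
proof -
  define S where "S k = qcross q a b c d k (m - k) + qcross q a b c d (m - k) k" for k
  have f0: "0 \<le> f n" for n
    using f by (simp add: doubly_positive_def)
  have qq: "0 < qpoch q q k" for k
    using q by (simp add: qpoch_pos)
  \<comment> \<open>Here \<open>u k = f k * f (m - k)\<close>. The sign change of \<open>S\<close>
    is governed by \<open>qpair_single_crossing\<close>, and its total is twice the sum in
    \<open>qcross_sum_nonneg\<close>.\<close>
  have "0 \<le> (\<Sum>k\<le>m. f k * f (m - k) * S k)"
  proof (rule sum_single_crossing_nonneg)
    fix k assume k: "2 * Suc k \<le> m" and S: "0 \<le> S k"
    have eq: "m - k = Suc (m - Suc k)" using k by simp
    from S have "0 \<le> (qpair q b c k (m - k) - qpair q a d k (m - k)) / (qpoch q q k * qpoch q q (m - k))"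
      unfolding S_def qcross_symmetrize .
    moreover have "0 < qpoch q q k * qpoch q q (m - k)"
      using qq by (intro mult_pos_pos)
    ultimately have "qpair q a d k (Suc (m - Suc k)) \<le> qpair q b c k (Suc (m - Suc k))"
      unfolding eq[symmetric] by (simp add: zero_le_divide_iff del: mult_pos_pos)
    then have "qpair q a d (Suc k) (m - Suc k) \<le> qpair q b c (Suc k) (m - Suc k)"
      using ord prod k by (intro qpair_single_crossing[OF q]) auto
    then show "0 \<le> S (Suc k)"
      unfolding S_def qcross_symmetrize using qq[of "Suc k"] qq[of "m - Suc k"] by simp
  next
    have "0 \<le> (\<Sum>k\<le>m. qcross q a b c d k (m - k))"
      using spread_sum_less[of d c b a] ord prod by (intro qcross_sum_nonneg[OF q]) auto
    then show "0 \<le> (\<Sum>k\<le>m. S k)"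
      using sum_atMost_symmetrize[of "\<lambda>k. qcross q a b c d k (m - k)" m]
      by (simp add: S_def cong: sum.cong_simp)
  qed (use log_concave_pair_mono[OF f] f0 in \<open>auto simp: S_def\<close>)
  also have "\<dots> = 2 * qcross_coeff q a b c d f m"
    unfolding qcross_coeff_def sum_atMost_symmetrize
    by (intro sum.cong) (auto simp: S_def algebra_simps)
  finally show ?thesis by simp
qed

text \<open>For the powers of \<open>q\<close> in question
  \<open>a + d - b - c = q^\<mu> (1 - q^\<alpha>)(1 - q^\<beta>)\<close>, so this is the coefficient
  in the claimed lower bound.\<close>

lemma qcross_coeff_1: "qcross_coeff q a b c d f 1 = f 0 * f 1 * ((a + d - b - c) / (1 - q))"
proof -
  have "qcross q a b c d 0 1 + qcross q a b c d 1 0 = (a + d - b - c) / (1 - q)"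
    by (simp add: qcross_def qpoch_Suc flip: add_divide_distrib)
  moreover have "qcross_coeff q a b c d f 1
    = f 0 * f 1 * (qcross q a b c d 0 1 + qcross q a b c d 1 0)"
    by (simp add: qcross_coeff_def algebra_simps)
  ultimately show ?thesis by simp
qed

text \<open>\<open>M\<close> and \<open>N\<close> are the factors of \<open>f_1^2\<close> and
  \<open>f_0 f_2\<close>. \<open>N\<close> may be negative, but \<open>M\<close> and
  \<open>M + N\<close> are positive, and log-concavity gives
  \<open>f_0 f_2 \<le> f_1^2\<close>.\<close>

lemma qcross_coeff_2_pos:
  assumes q: "0 < q" "q < 1"
    and ord: "0 < d" "d < c" "c \<le> b" "b < a" "a \<le> 1" and prod: "a * d = b * c"
    and f: "doubly_positive f" "0 < f 0" "0 < f 1"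
  shows "0 < qcross_coeff q a b c d f 2"
proof -
  define s where "s = a + d - b - c"
  have s: "0 < s"
    unfolding s_def using spread_sum_less[of d c b a] ord prod by simp
  define M where "M = qcross q a b c d 1 1"
  define N where "N = qcross q a b c d 0 2 + qcross q a b c d 2 0"
  have q2: "0 < (1 - q) * (1 - q * q)"
    using q mult_strict_mono[of q 1 q 1] by simp
  then have nz: "q \<noteq> 1" "q * q \<noteq> 1" by auto
  have M: "M = s / (1 - q)\<^sup>2"
    unfolding M_def qcross_def s_def using prod
    by (simp add: qpoch_Suc power2_eq_square) (simp add: algebra_simps)
  have N: "N = s * (1 + q - q * (a + b + c + d)) / ((1 - q) * (1 - q * q))"
  proof -
    have "N * ((1 - q) * (1 - q * q)) = (1 - b) * (1 - b * q) + (1 - c) * (1 - c * q)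
       - (1 - a) * (1 - a * q) - (1 - d) * (1 - d * q)"
      unfolding N_def qcross_def using q2 nz
      by (simp add: numeral_2_eq_2 qpoch_Suc flip: add_divide_distrib)
    also have "\<dots> = s * (1 + q - q * (a + b + c + d))"
      unfolding s_def using prod by algebra
    finally show ?thesis using q2 by (simp add: field_simps)
  qed
  have M0: "0 < M" using s q M by simp
  \<comment> \<open>Over the denominator of \<open>N\<close>, the bracket of \<open>M + N\<close> is
    \<open>2(1 + q) - q(a + b + c + d)\<close>, regrouped as
    \<open>2(1 - q) + q(4 - (a + b + c + d))\<close> to show its sign.\<close>
  have "M = s * (1 + q) / ((1 - q) * (1 - q * q))"
  proof -
    have "(1 - q) * (1 - q * q) = (1 - q)\<^sup>2 * (1 + q)" by (simp add: power2_eq_square algebra_simps)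
    then show ?thesis using M q by simp
  qed
  then have "M + N = s * (2 * (1 - q) + q * (4 - (a + b + c + d))) / ((1 - q) * (1 - q * q))"
    unfolding N by (simp add: add_divide_distrib[symmetric] algebra_simps)
  also have "0 < \<dots>"
    using q ord s by (intro divide_pos_pos[OF mult_pos_pos q2] add_pos_nonneg) auto
  finally have MN: "0 < M + N" .
  have t: "f 0 * f 2 \<le> (f 1)\<^sup>2" "0 \<le> f 0 * f 2"
    using f(1) unfolding doubly_positive_def by (auto dest: spec[of _ 1] simp: numeral_2_eq_2)
  have "qcross_coeff q a b c d f 2 = (f 1)\<^sup>2 * M + f 0 * f 2 * N"
    unfolding qcross_coeff_def M_def N_def
    by (simp add: numeral_2_eq_2 algebra_simps)
  also have "\<dots> = f 0 * f 2 * (M + N) + ((f 1)\<^sup>2 - f 0 * f 2) * M"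
    by (simp add: algebra_simps)
  also have "0 < \<dots>"
  proof (cases "f 0 * f 2 = 0")
    case True
    then show ?thesis using M0 f by auto
  next
    case False
    then have "0 < f 0 * f 2 * (M + N)"
      using t(2) by (intro mult_pos_pos[OF _ MN]) (simp only: less_le, simp)
    then show ?thesis using t M0 by (intro add_pos_nonneg mult_nonneg_nonneg) auto
  qed
  finally show ?thesis .
qed

text \<open>It holds factor by factor: by \<open>ad = bc\<close>, the factors at
  \<open>t = q^k\<close> differ by \<open>t (a + d - b - c) > 0\<close>.\<close>

lemma qpoch_mult_less:
  assumes q: "0 < q" "q < 1"
    and ord: "0 < d" "d < c" "c \<le> b" "b < a" "a \<le> 1" and prod: "a * d = b * c" and "0 < n"
  shows "qpoch a q n * qpoch d q n < qpoch b q n * qpoch c q n"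
proof -
  have fac: "(1 - a * t) * (1 - d * t) < (1 - b * t) * (1 - c * t)" if "0 < t" for t
  proof -
    have "(1 - b * t) * (1 - c * t) - (1 - a * t) * (1 - d * t) = t * (a + d - b - c)"
      using prod by algebra
    also have "0 < \<dots>" using that spread_sum_less[of d c b a] ord prod by simp
    finally show ?thesis by simp
  qed
  have pos: "0 \<le> 1 - u * q ^ k" if "0 \<le> u" "u \<le> 1" for u k
    using that q mult_le_one[of u "q ^ k"] by (simp add: power_le_one)
  have "(\<Prod>k<n. (1 - a * q ^ k) * (1 - d * q ^ k)) < (\<Prod>k<n. (1 - b * q ^ k) * (1 - c * q ^ k))"
  proof (rule prod_mono_strict[of 0])
    fix k
    have "0 \<le> (1 - a * q ^ k) * (1 - d * q ^ k)"
      using pos ord by simp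
    then show "0 \<le> (1 - a * q ^ k) * (1 - d * q ^ k) \<and>
          (1 - a * q ^ k) * (1 - d * q ^ k) \<le> (1 - b * q ^ k) * (1 - c * q ^ k)"
      and "0 < (1 - b * q ^ k) * (1 - c * q ^ k)"
      using fac[of "q ^ k"] q by auto
  qed (use \<open>0 < n\<close> fac[of "q ^ 0"] in auto)
  then show ?thesis
    by (simp add: qpoch_def prod.distrib)
qed

text \<open>Strictness when \<open>f 0 = 0\<close>: with \<open>N\<close> the first nonzero index,
  every term except \<open>k = N\<close> contains an \<open>f\<close> at an index below
  \<open>N\<close>.\<close>

lemma qcross_coeff_double_pos:
  assumes q: "0 < q" "q < 1"
    and ord: "0 < d" "d < c" "c \<le> b" "b < a" "a \<le> 1" and prod: "a * d = b * c"
    and N: "0 < N" "f N \<noteq> 0" "\<And>k. k < N \<Longrightarrow> f k = 0"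
  shows "0 < qcross_coeff q a b c d f (2 * N)"
proof -
  have "qcross_coeff q a b c d f (2 * N) =
    (\<Sum>k\<in>{N}. f k * f (2 * N - k) * qcross q a b c d k (2 * N - k))"
    unfolding qcross_coeff_def
  proof (intro sum.mono_neutral_right ballI)
    fix k assume "k \<in> {..2 * N} - {N}"
    then have "k < N \<or> 2 * N - k < N" by auto
    then show "f k * f (2 * N - k) * qcross q a b c d k (2 * N - k) = 0"
      using N(3) by auto
  qed auto
  also have "\<dots> = (f N)\<^sup>2 * qcross q a b c d N N"
    by (simp add: power2_eq_square)
  also have "0 < \<dots>"
    using qpoch_mult_less[OF q ord prod N(1)] N(2) qpoch_pos[of q q N] q
    by (auto simp: qcross_def intro!: mult_pos_pos divide_pos_pos)
  finally show ?thesis .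
qed

text \<open>The value \<open>a = 1\<close> arises from \<open>\<mu> = 0\<close>; there only the
  constant term survives, whereas the radius is defined through \<open>a < 1\<close>.\<close>

lemma qseries_summable:
  assumes q: "0 < q" "q < 1" and a: "0 < a" "a \<le> 1" and x: "0 \<le> x" "ereal x < qradius q f"
  shows "summable (\<lambda>n. norm (qcoeff q f a n * x ^ n))"
proof (cases "a = 1")
  case True
  then show ?thesis
    by (intro summable_finite[of "{0}"]) (auto simp: qcoeff_def qpoch_one)
next
  case False
  then show ?thesis
    using a x qradius_eq[OF q] conv_radius_qcoeff[OF q, of a f]
    by (intro abs_summable_in_conv_radius) auto
qed

lemma qcross_coeff_sums:
  assumes q: "0 < q" "q < 1" and "0 < a" "a \<le> 1" "0 < b" "b \<le> 1" "0 < c" "c \<le> 1" "0 < d" "d \<le> 1"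
    and x: "0 \<le> x" "ereal x < qradius q f"
  shows "(\<lambda>m. qcross_coeff q a b c d f m * x ^ m) sums
    (qseries q f b x * qseries q f c x - qseries q f a x * qseries q f d x)"
proof -
  have product: "(\<lambda>m. \<Sum>k\<le>m. (qcoeff q f u k * x ^ k) * (qcoeff q f v (m - k) * x ^ (m - k))) sums
    (qseries q f u x * qseries q f v x)" if "0 < u" "u \<le> 1" "0 < v" "v \<le> 1" for u v
    unfolding qseries_def using that by (intro Cauchy_product_sums qseries_summable q x)
  have "(\<lambda>m. (\<Sum>k\<le>m. (qcoeff q f b k * x ^ k) * (qcoeff q f c (m - k) * x ^ (m - k))) -
     (\<Sum>k\<le>m. (qcoeff q f a k * x ^ k) * (qcoeff q f d (m - k) * x ^ (m - k)))) sums
    (qseries q f b x * qseries q f c x - qseries q f a x * qseries q f d x)"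
    using assms by (intro sums_diff product)
  also have "(\<lambda>m. (\<Sum>k\<le>m. (qcoeff q f b k * x ^ k) * (qcoeff q f c (m - k) * x ^ (m - k))) -
     (\<Sum>k\<le>m. (qcoeff q f a k * x ^ k) * (qcoeff q f d (m - k) * x ^ (m - k)))) =
     (\<lambda>m. qcross_coeff q a b c d f m * x ^ m)"
  proof
    fix m
    have "(qcoeff q f b k * x ^ k) * (qcoeff q f c (m - k) * x ^ (m - k)) -
      (qcoeff q f a k * x ^ k) * (qcoeff q f d (m - k) * x ^ (m - k))
      = f k * f (m - k) * qcross q a b c d k (m - k) * x ^ m" if "k \<le> m" for k
    proof -
      have "x ^ m = x ^ k * x ^ (m - k)" using that by (simp flip: power_add)
      then show ?thesis
        by (simp add: qcoeff_def qcross_def diff_divide_distrib algebra_simps)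
    qed
    then show "(\<Sum>k\<le>m. (qcoeff q f b k * x ^ k) * (qcoeff q f c (m - k) * x ^ (m - k))) -
     (\<Sum>k\<le>m. (qcoeff q f a k * x ^ k) * (qcoeff q f d (m - k) * x ^ (m - k))) =
      qcross_coeff q a b c d f m * x ^ m"
      by (simp add: qcross_coeff_def sum_distrib_right flip: sum_subtractf)
  qed
  finally show ?thesis .
qed

text \<open>With nonnegative coefficients the sum dominates its finite parts: \<open>{1}\<close>
  gives the bound, \<open>{1, m}\<close> with \<open>C m > 0\<close> its strictness. If
  \<open>f 0 \<noteq> 0\<close>, the absence of internal zeros yields \<open>f 1 > 0\<close>, and
  \<open>m = 2\<close>; otherwise \<open>m = 2 * N\<close> for the first nonzero index
  \<open>N\<close>.\<close>

lemma qseries_lower_bound: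
  assumes q: "0 < q" "q < 1"
    and ord: "0 < d" "d < c" "c \<le> b" "b < a" "a \<le> 1" and prod: "a * d = b * c"
    and f: "doubly_positive f" and x: "0 \<le> x" "ereal x < qradius q f"
  shows "f 0 * f 1 * ((a + d - b - c) / (1 - q)) * x
      \<le> qseries q f b x * qseries q f c x - qseries q f a x * qseries q f d x" (is "?L \<le> ?D")
    and "\<exists>n\<ge>1. f n \<noteq> 0 \<Longrightarrow> 0 < x \<Longrightarrow> f 0 * f 1 * ((a + d - b - c) / (1 - q)) * x
      < qseries q f b x * qseries q f c x - qseries q f a x * qseries q f d x"
proof -
  define C where "C = qcross_coeff q a b c d f"
  have sums: "(\<lambda>m. C m * x ^ m) sums ?D"
    unfolding C_def using ord by (intro qcross_coeff_sums[OF q]) (use x in auto)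
  have C0: "0 \<le> C m" for m
    unfolding C_def by (rule qcross_coeff_nonneg[OF q ord prod f])
  have part: "(\<Sum>m\<in>I. C m * x ^ m) \<le> ?D" if "finite I" for I
    using sum_le_suminf[OF sums_summable[OF sums] that] C0 x sums_unique[OF sums] by auto
  have C1: "?L = C 1 * x"
    unfolding C_def qcross_coeff_1 by simp
  show "?L \<le> ?D"
    using part[of "{1}"] C1 by simp
  assume ex: "\<exists>n\<ge>1. f n \<noteq> 0" and x0: "0 < x"
  obtain m where m: "2 \<le> m" "0 < C m"
  proof (cases "f 0 = 0")
    case False
    have f0: "0 < f 0"
      using f False by (auto simp: doubly_positive_def less_le)
    have "f 1 \<noteq> 0"
    proof
      assume "f 1 = 0"
      then have "(\<forall>i. f (1 + i) = 0) \<or> (\<forall>i\<le>1. f (1 - i) = 0)"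
        using f by (simp only: doubly_positive_def)
      then show False
      proof
        assume z: "\<forall>i. f (1 + i) = 0"
        obtain n where "n \<ge> 1" "f n \<noteq> 0" using ex by blast
        then show False using spec[OF z, of "n - 1"] by simp
      next
        assume "\<forall>i\<le>1. f (1 - i) = 0"
        from spec[OF this, of 1] show False using False by simp
      qed
    qed
    then have "0 < f 1"
      using f by (auto simp: doubly_positive_def less_le)
    then show ?thesis
      using that[of 2] qcross_coeff_2_pos[OF q ord prod f f0] by (simp add: C_def)
  next
    case True
    define N where "N = (LEAST n. f n \<noteq> 0)"
    have N: "f N \<noteq> 0" unfolding N_def by (rule LeastI_ex[of "\<lambda>n. f n \<noteq> 0"]) (use ex in blast)
    moreover have "f k = 0" if "k < N" for k
      using that not_less_Least unfolding N_def by blast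
    moreover have "0 < N" using N True by (cases N) auto
    ultimately show ?thesis
      using that[of "2 * N"] qcross_coeff_double_pos[OF q ord prod] by (simp add: C_def)
  qed
  have "?L < C 1 * x + C m * x ^ m"
    using C1 m x0 by simp
  also have "\<dots> = (\<Sum>m\<in>{1, m}. C m * x ^ m)"
    using m by simp
  also have "\<dots> \<le> ?D" by (rule part) simp
  finally show "?L < ?D" .
qed

subsection \<open>The upper bound\<close>

text \<open>Apply \<open>ln z \<le> z - 1\<close> at \<open>u / A\<close> and \<open>v / A\<close>,
  where \<open>A\<close> is the weighted arithmetic mean; the first is strict, as
  \<open>u \<noteq> v\<close> gives \<open>u \<noteq> A\<close>.\<close>

lemma Youngs_inequality_strict:
  fixes u v l :: real
  assumes "0 < u" "0 < v" "u \<noteq> v" "0 < l" "l < 1"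
  shows "u powr (1 - l) * v powr l < (1 - l) * u + l * v"
proof -
  define A where "A = (1 - l) * u + l * v"
  have A: "0 < A"
    unfolding A_def using assms by (intro add_pos_pos mult_pos_pos) auto
  have "u / A \<noteq> 1"
  proof
    assume "u / A = 1"
    then have "l * (v - u) = 0" using A by (simp add: A_def algebra_simps)
    then show False using assms by simp
  qed
  then have "ln (u / A) < u / A - 1"
    using ln_le_minus_one[of "u / A"] ln_eq_minus_one[of "u / A"] A assms by fastforce
  then have "(1 - l) * ln (u / A) < (1 - l) * (u / A - 1)"
    using assms by simp
  moreover have "l * ln (v / A) \<le> l * (v / A - 1)"
    using ln_le_minus_one[of "v / A"] A assms by (intro mult_left_mono) auto
  moreover have "(1 - l) * (u / A - 1) + l * (v / A - 1) = A / A - 1"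
  proof -
    have "(1 - l) * (u / A - 1) + l * (v / A - 1) = ((1 - l) * u + l * v) / A - 1"
      by (simp add: algebra_simps add_divide_distrib diff_divide_distrib)
    then show ?thesis by (simp add: A_def)
  qed
  ultimately have "(1 - l) * ln u + l * ln v < ln A"
    using A assms by (simp add: ln_div algebra_simps)
  then have "exp ((1 - l) * ln u + l * ln v) < exp (ln A)"
    by simp
  then show ?thesis
    using A assms by (simp add: powr_def exp_add A_def)
qed

lemma qpoch_inf_lim:
  assumes "0 < q" "q < 1" "0 < a" "a < 1"
  shows "qpoch a q \<longlonglongrightarrow> qpoch_inf a q" and "0 < qpoch_inf a q"
proof -
  obtain L where L: "L \<noteq> 0" "qpoch a q \<longlonglongrightarrow> L"
    using qpoch_nz_limit assms by blast
  have eq: "qpoch_inf a q = L"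
    unfolding qpoch_inf_def using L(2) by (rule limI)
  have "0 \<le> L"
    using L(2) qpoch_pos[of q a] assms by (intro LIMSEQ_le_const[OF L(2)]) (auto intro: less_imp_le)
  then show "qpoch a q \<longlonglongrightarrow> qpoch_inf a q" "0 < qpoch_inf a q"
    using L eq by auto
qed

lemma qpoch_inf_1: "qpoch_inf 1 q = 0"
proof -
  have "qpoch 1 q \<longlonglongrightarrow> 0"
    by (rule tendsto_eventually) (auto simp: qpoch_one eventually_sequentially intro!: exI[of _ 1])
  then show ?thesis unfolding qpoch_inf_def by (rule limI)
qed

lemma scaled_unit_interval:
  fixes a q :: real
  assumes "0 < q" "q < 1" "0 < a" "a < 1"
  shows "0 < a * q ^ n" "a * q ^ n < 1"
proof -
  have "a * q ^ n \<le> a * 1" using assms by (intro mult_left_mono power_le_one) auto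
  then show "a * q ^ n < 1" using assms by linarith
qed (use assms in simp)

lemma qpoch_inf_split:
  assumes "0 < q" "q < 1" "0 < a" "a < 1"
  shows "qpoch_inf a q = qpoch a q n * qpoch_inf (a * q ^ n) q"
proof (rule LIMSEQ_unique)
  show "(\<lambda>k. qpoch a q (n + k)) \<longlonglongrightarrow> qpoch_inf a q"
    using LIMSEQ_ignore_initial_segment[OF qpoch_inf_lim(1)[OF assms], of n] by (simp add: add.commute)
  show "(\<lambda>k. qpoch a q (n + k)) \<longlonglongrightarrow> qpoch a q n * qpoch_inf (a * q ^ n) q"
    unfolding qpoch_add
    by (intro tendsto_mult_left qpoch_inf_lim assms scaled_unit_interval)
qed

text \<open>Two mean inequalities per factor: the geometric mean of \<open>1 - at\<close> and
  \<open>1 - dt\<close> is at most their arithmetic mean, which is at most \<open>1 - bt\<close>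
  because \<open>b\<close> is at most the arithmetic mean of \<open>a\<close> and
  \<open>d\<close>.\<close>

lemma qpoch_log_concave:
  assumes q: "0 < q" "q < 1" and ad: "0 < a" "a < 1" "0 < d" "d < 1" and l: "0 < l" "l < 1"
    and b: "b = a powr (1 - l) * d powr l"
  shows "qpoch a q n powr (1 - l) * qpoch d q n powr l \<le> qpoch b q n"
proof (induction n)
  case (Suc n)
  define t where "t = q ^ n"
  have t: "0 < t" "0 < 1 - a * t" "0 < 1 - d * t"
    unfolding t_def using q ad scaled_unit_interval[OF q] by auto
  have "b \<le> (1 - l) * a + l * d"
    unfolding b using ad l by (intro Youngs_inequality_0) auto
  then have "b * t \<le> ((1 - l) * a + l * d) * t"
    using t by (intro mult_right_mono) auto
  moreover have "(1 - a * t) powr (1 - l) * (1 - d * t) powr l \<le> (1 - l) * (1 - a * t) + l * (1 - d * t)"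
    using t l by (intro Youngs_inequality_0) auto
  ultimately have "(1 - a * t) powr (1 - l) * (1 - d * t) powr l \<le> 1 - b * t"
    by (simp add: algebra_simps)
  then have "(qpoch a q n powr (1 - l) * qpoch d q n powr l) * ((1 - a * t) powr (1 - l) * (1 - d * t) powr l)
     \<le> qpoch b q n * (1 - b * t)"
    using Suc by (intro mult_mono') auto
  then show ?case
    using qpoch_pos[OF q, of a n] qpoch_pos[OF q, of d n] ad t
    by (simp add: qpoch_Suc powr_mult mult_ac flip: t_def)
qed simp

text \<open>Lets log-concavity be applied to the parameters multiplied by
  \<open>q^k\<close>.\<close>

lemma powr_geometric_mean_scale:
  fixes a d t l :: real
  assumes "0 < a" "0 < d" "0 < t"
  shows "(a * t) powr (1 - l) * (d * t) powr l = a powr (1 - l) * d powr l * t"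
proof -
  have "t powr (1 - l) * t powr l = t"
    using assms by (simp flip: powr_add)
  moreover have "(a * t) powr (1 - l) * (d * t) powr l
    = a powr (1 - l) * d powr l * (t powr (1 - l) * t powr l)"
    using assms by (simp add: powr_mult)
  ultimately show ?thesis by simp
qed

lemma geometric_mean_between:
  fixes a d l :: real
  assumes "0 < d" "d < a" "0 < l" "l < 1"
  shows "d < a powr (1 - l) * d powr l" "a powr (1 - l) * d powr l < a"
proof -
  have "d powr (1 - l) * d powr l < a powr (1 - l) * d powr l"
    using assms by (intro mult_strict_right_mono powr_less_mono2) auto
  then show "d < a powr (1 - l) * d powr l"
    using assms by (simp flip: powr_add)
  have "a powr (1 - l) * d powr l < a powr (1 - l) * a powr l"
    using assms by (intro mult_strict_left_mono powr_less_mono2) auto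
  then show "a powr (1 - l) * d powr l < a"
    using assms by (simp flip: powr_add)
qed

text \<open>A limit preserves only weak inequalities, so the factor \<open>1 - b\<close> is split
  off first: it carries the strictness, and the limit of \<open>qpoch_log_concave\<close> bounds the
  rest.\<close>

lemma qpoch_inf_log_concave:
  assumes q: "0 < q" "q < 1" and ad: "0 < d" "d < a" "a < 1" and l: "0 < l" "l < 1"
    and b: "b = a powr (1 - l) * d powr l"
  shows "qpoch_inf a q powr (1 - l) * qpoch_inf d q powr l < qpoch_inf b q"
proof -
  have b01: "0 < b" "b < 1"
    using geometric_mean_between[of d a l] ad l b by auto
  have d1: "d < 1" and a0: "0 < a" using ad by auto
  have split: "qpoch_inf t q = (1 - t) * qpoch_inf (t * q) q" if "0 < t" "t < 1" for t
    using qpoch_inf_split[OF q that, of 1] by (simp add: qpoch_def)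
  have sc: "0 < t * q" "t * q < 1" if "0 < t" "t < 1" for t
    using scaled_unit_interval[OF q that, of 1] by simp_all
  have bq: "b * q = (a * q) powr (1 - l) * (d * q) powr l"
    using powr_geometric_mean_scale[of a d q l] a0 ad q b by simp
  have le: "qpoch_inf (a * q) q powr (1 - l) * qpoch_inf (d * q) q powr l \<le> qpoch_inf (b * q) q"
  proof (rule LIMSEQ_le)
    show "(\<lambda>n. qpoch (a * q) q n powr (1 - l) * qpoch (d * q) q n powr l) \<longlonglongrightarrow>
        qpoch_inf (a * q) q powr (1 - l) * qpoch_inf (d * q) q powr l"
      using qpoch_inf_lim(2)[OF q, of "a * q"] qpoch_inf_lim(2)[OF q, of "d * q"] sc a0 ad d1 q
      by (intro tendsto_mult tendsto_powr qpoch_inf_lim tendsto_const) auto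
    show "qpoch (b * q) q \<longlonglongrightarrow> qpoch_inf (b * q) q"
      by (intro qpoch_inf_lim q sc b01)
    show "\<exists>N. \<forall>n\<ge>N. qpoch (a * q) q n powr (1 - l) * qpoch (d * q) q n powr l \<le> qpoch (b * q) q n"
      by (intro exI allI impI qpoch_log_concave[OF q sc sc l bq] a0 ad(1,3) d1)
  qed
  have "b < (1 - l) * a + l * d"
    unfolding b using ad l by (intro Youngs_inequality_strict) auto
  moreover have "(1 - a) powr (1 - l) * (1 - d) powr l \<le> (1 - l) * (1 - a) + l * (1 - d)"
    using ad l by (intro Youngs_inequality_0) auto
  ultimately have lt: "(1 - a) powr (1 - l) * (1 - d) powr l < 1 - b"
    by (simp add: algebra_simps)
  have "qpoch_inf a q powr (1 - l) * qpoch_inf d q powr l =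
    ((1 - a) powr (1 - l) * (1 - d) powr l) *
    (qpoch_inf (a * q) q powr (1 - l) * qpoch_inf (d * q) q powr l)"
    unfolding split[OF a0 ad(3)] split[OF ad(1) d1]
    using ad qpoch_inf_lim(2)[OF q sc[OF a0 ad(3)]] qpoch_inf_lim(2)[OF q sc[OF ad(1) d1]]
    by (simp add: powr_mult)
  also have "\<dots> < (1 - b) * qpoch_inf (b * q) q"
    using lt le qpoch_inf_lim(2)[OF q sc[OF a0 ad(3)]] qpoch_inf_lim(2)[OF q sc[OF ad(1) d1]]
    by (intro mult_less_le_imp_less) auto
  also have "\<dots> = qpoch_inf b q"
    using split[OF b01] by simp
  finally show ?thesis .
qed

text \<open>The index \<open>n\<close> excludes the zero series; for \<open>x = 0\<close> it can
  only be \<open>0\<close>, forcing \<open>f 0 > 0\<close>.\<close>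

lemma qseries_pos:
  assumes q: "0 < q" "q < 1" and a: "0 < a" "a < 1" and f: "\<And>n. 0 \<le> f n"
    and x: "0 \<le> x" "ereal x < qradius q f" and n: "0 < f n * x ^ n"
  shows "0 < qseries q f a x"
  unfolding qseries_def
proof (rule suminf_pos2)
  show "summable (\<lambda>n. qcoeff q f a n * x ^ n)"
    by (rule summable_norm_cancel[OF qseries_summable[OF q _ _ x]]) (use a in auto)
  have r: "0 < qpoch a q k / qpoch q q k" for k
    using q a by (intro divide_pos_pos qpoch_pos) auto
  have eq: "qcoeff q f a k * x ^ k = (f k * x ^ k) * (qpoch a q k / qpoch q q k)" for k
    by (simp add: qcoeff_def)
  show "0 \<le> qcoeff q f a k * x ^ k" for k
    unfolding eq using x by (intro mult_nonneg_nonneg f less_imp_le[OF r] zero_le_power)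
  show "0 < qcoeff q f a n * x ^ n"
    unfolding eq by (rule mult_pos_pos[OF n r])
qed

text \<open>
  Hoelder's inequality, proved termwise by Young's inequality after normalizing both series on the
  right to have sum \<open>1\<close>.
\<close>

lemma qseries_log_convex:
  assumes q: "0 < q" "q < 1" and ad: "0 < d" "d < a" "a < 1" and l: "0 < l" "l < 1"
    and b: "b = a powr (1 - l) * d powr l"
    and f: "\<And>n. 0 \<le> f n" and x: "0 \<le> x" "ereal x < qradius q f" and n: "0 < f n * x ^ n"
  shows "qseries q f b x / qpoch_inf b q
    < (qseries q f a x / qpoch_inf a q) powr (1 - l) * (qseries q f d x / qpoch_inf d q) powr l"
proof -
  have a0: "0 < a" and d1: "d < 1" using ad by auto
  have b01: "0 < b" "b < 1"
    using geometric_mean_between[of d a l] ad l b by auto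
  define g where "g t k = qcoeff q f t k * x ^ k / qpoch_inf t q" for t k
  define w where "w k = f k * x ^ k / qpoch q q k" for k
  \<comment> \<open>Splitting \<open>(t;q)_\<infinity>\<close> at \<open>k\<close> leaves
    \<open>t\<close> only in \<open>(t q^k;q)_\<infinity>\<close>, to which
    \<open>qpoch_inf_log_concave\<close> applies.\<close>
  have g: "g t k = w k / qpoch_inf (t * q ^ k) q" if "0 < t" "t < 1" for t k
    using qpoch_inf_split[OF q that, of k] qpoch_pos[OF q, of t k] that
    by (simp add: g_def w_def qcoeff_def)
  have w0: "0 \<le> w k" for k
    unfolding w_def using f x q by (auto intro!: divide_nonneg_pos qpoch_pos)
  have wn: "0 < w n"
    unfolding w_def using n q by (auto intro!: divide_pos_pos qpoch_pos)
  have sums: "g t sums (qseries q f t x / qpoch_inf t q)" if "0 < t" "t < 1" for t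
    unfolding g_def qseries_def
    by (intro sums_divide summable_sums summable_norm_cancel[OF qseries_summable[OF q _ _ x]])
      (use that in auto)
  define U V where UV: "U = qseries q f a x / qpoch_inf a q" "V = qseries q f d x / qpoch_inf d q"
  have U: "0 < U" and V: "0 < V"
    unfolding UV using qseries_pos[OF q _ _ f x n] qpoch_inf_lim(2)[OF q] a0 ad d1 by auto
  define C where "C = U powr (1 - l) * V powr l"
  \<comment> \<open>The termwise gap: \<open>g a k / U\<close> and \<open>g d k / V\<close> each sum
    to \<open>1\<close>, so \<open>h\<close> sums to \<open>C\<close>, the right-hand side, minus
    the left-hand side.\<close>
  define h where "h k = C * ((1 - l) * (g a k / U) + l * (g d k / V)) - g b k" for k
  have h: "0 \<le> h k" "0 < w k \<Longrightarrow> 0 < h k" for k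
  proof -
    note sc = scaled_unit_interval[OF q, of _ k]
    define A B E where "A = qpoch_inf (a * q ^ k) q" "B = qpoch_inf (b * q ^ k) q" "E = qpoch_inf (d * q ^ k) q"
    have pos: "0 < A" "0 < B" "0 < E"
      unfolding A_B_E_def using qpoch_inf_lim(2)[OF q sc] a0 ad d1 b01 by auto
    have lc: "A powr (1 - l) * E powr l < B"
      unfolding A_B_E_def
    proof (rule qpoch_inf_log_concave[OF q _ _ _ l])
      show "b * q ^ k = (a * q ^ k) powr (1 - l) * (d * q ^ k) powr l"
        using powr_geometric_mean_scale[of a d "q ^ k" l] a0 ad q b by simp
    qed (use sc a0 ad d1 q in auto)
    have *: "0 < h k" if w: "0 < w k"
    proof -
      have "g b k = w k / B"
        using g[OF b01] by (simp add: A_B_E_def)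
      also have "\<dots> < w k / (A powr (1 - l) * E powr l)"
        using lc w pos by (intro divide_strict_left_mono mult_pos_pos) auto
      also have "\<dots> = (w k powr (1 - l) * w k powr l) / (A powr (1 - l) * E powr l)"
        using w by (simp flip: powr_add)
      also have "\<dots> = g a k powr (1 - l) * g d k powr l"
        using g[OF a0 ad(3)] g[OF ad(1) d1] w pos by (simp add: A_B_E_def powr_divide)
      also have "\<dots> = C * ((g a k / U) powr (1 - l) * (g d k / V) powr l)"
      proof -
        have "0 < g a k" "0 < g d k"
          using g[OF a0 ad(3)] g[OF ad(1) d1] w pos by (simp_all add: A_B_E_def)
        then show ?thesis
          using U V by (simp add: C_def powr_divide)
      qed
      also have "\<dots> \<le> C * ((1 - l) * (g a k / U) + l * (g d k / V))"
        using U V g[OF a0 ad(3)] g[OF ad(1) d1] w pos l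
        by (intro mult_left_mono Youngs_inequality_0) (auto simp: C_def A_B_E_def[symmetric])
      finally show ?thesis by (simp add: h_def)
    qed
    then show "0 < w k \<Longrightarrow> 0 < h k" .
    show "0 \<le> h k"
    proof (cases "w k = 0")
      case True
      then show ?thesis using g a0 ad d1 b01 by (simp add: h_def)
    next
      case False
      then show ?thesis using * w0[of k] by simp
    qed
  qed
  have hs: "h sums (C * ((1 - l) * (U / U) + l * (V / V)) - qseries q f b x / qpoch_inf b q)"
    unfolding h_def using sums[OF a0 ad(3)] sums[OF ad(1) d1] sums[OF b01]
    unfolding UV[symmetric] by (intro sums_diff sums_mult sums_add sums_divide)
  have "0 < suminf h"
    using suminf_pos2[OF sums_summable[OF hs] h(1) h(2)[OF wn]] .
  then show ?thesis
    using sums_unique[OF hs] U V unfolding UV[symmetric] C_def by simp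
qed

text \<open>Log-convexity is used at both intermediate parameters; their weights are complementary,
  so the product of the two bounds collapses to \<open>U * V\<close>.\<close>

lemma qseries_upper_bound:
  assumes q: "0 < q" "q < 1" and pos: "0 < \<mu>" "0 < \<alpha>" "0 < \<beta>"
    and f: "\<And>n. 0 \<le> f n" and x: "0 \<le> x" "ereal x < qradius q f" and n: "0 < f n * x ^ n"
  shows "qpoch_inf (q powr \<mu>) q * qpoch_inf (q powr (\<mu> + \<alpha> + \<beta>)) q
        / (qpoch_inf (q powr (\<mu> + \<alpha>)) q * qpoch_inf (q powr (\<mu> + \<beta>)) q)
      < qseries q f (q powr \<mu>) x * qseries q f (q powr (\<mu> + \<alpha> + \<beta>)) x
        / (qseries q f (q powr (\<mu> + \<alpha>)) x * qseries q f (q powr (\<mu> + \<beta>)) x)"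
proof -
  \<comment> \<open>Chosen so that \<open>\<mu> + \<alpha> = (1 - l) \<mu> + l (\<mu> + \<alpha> +
    \<beta>)\<close>; for \<open>\<mu> + \<beta>\<close> the weights are interchanged.\<close>
  define l where "l = \<alpha> / (\<alpha> + \<beta>)"
  have l: "0 < l" "l < 1" "l * (\<alpha> + \<beta>) = \<alpha>"
    using pos by (auto simp: l_def)
  have p01: "0 < q powr t" "q powr t < 1" if "0 < t" for t
    using powr_less_mono'[of q 0 t] that q by auto
  have mean: "q powr (\<mu> + s * (\<alpha> + \<beta>)) = (q powr \<mu>) powr (1 - s) * (q powr (\<mu> + \<alpha> + \<beta>)) powr s" for s
  proof -
    have "\<mu> + s * (\<alpha> + \<beta>) = \<mu> * (1 - s) + (\<mu> + \<alpha> + \<beta>) * s"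
      by (simp add: algebra_simps)
    then have "q powr (\<mu> + s * (\<alpha> + \<beta>)) = q powr (\<mu> * (1 - s)) * q powr ((\<mu> + \<alpha> + \<beta>) * s)"
      by (simp only: powr_add)
    then show ?thesis by (simp only: powr_powr)
  qed
  have lt: "q powr (\<mu> + \<alpha> + \<beta>) < q powr \<mu>"
    using q pos by (intro powr_less_mono') auto
  define U V where "U = qseries q f (q powr \<mu>) x / qpoch_inf (q powr \<mu>) q"
    and "V = qseries q f (q powr (\<mu> + \<alpha> + \<beta>)) x / qpoch_inf (q powr (\<mu> + \<alpha> + \<beta>)) q"
  have F: "0 < qseries q f (q powr t) x" and P: "0 < qpoch_inf (q powr t) q" if "0 < t" for t
    using qseries_pos[OF q p01[OF that] f x n] qpoch_inf_lim(2)[OF q p01[OF that]] by auto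
  have U: "0 < U" and V: "0 < V"
    unfolding U_def V_def by (intro divide_pos_pos F P; use pos in simp)+
  have conv: "qseries q f (q powr (\<mu> + s * (\<alpha> + \<beta>))) x / qpoch_inf (q powr (\<mu> + s * (\<alpha> + \<beta>))) q
    < U powr (1 - s) * V powr s" if "0 < s" "s < 1" for s
    unfolding U_def V_def
    by (rule qseries_log_convex[OF q _ lt _ that mean f x n]) (use p01 pos in auto)
  have b: "qseries q f (q powr (\<mu> + \<alpha>)) x / qpoch_inf (q powr (\<mu> + \<alpha>)) q < U powr (1 - l) * V powr l"
    using conv[OF l(1,2)] unfolding l(3) .
  have "(1 - l) * (\<alpha> + \<beta>) = \<beta>"
    unfolding left_diff_distrib l(3) by simp
  then have c: "qseries q f (q powr (\<mu> + \<beta>)) x / qpoch_inf (q powr (\<mu> + \<beta>)) q < U powr l * V powr (1 - l)"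
    using conv[of "1 - l"] l(1,2) by simp
  have "(qseries q f (q powr (\<mu> + \<alpha>)) x / qpoch_inf (q powr (\<mu> + \<alpha>)) q)
      * (qseries q f (q powr (\<mu> + \<beta>)) x / qpoch_inf (q powr (\<mu> + \<beta>)) q)
      < (U powr (1 - l) * V powr l) * (U powr l * V powr (1 - l))"
    by (intro mult_strict_mono'[OF b c] divide_nonneg_nonneg less_imp_le[OF F] less_imp_le[OF P])
      (use pos in auto)
  also have "\<dots> = (U powr (1 - l) * U powr l) * (V powr l * V powr (1 - l))"
    by (simp only: mult_ac)
  also have "\<dots> = U * V"
    using U V by (simp flip: powr_add)
  finally have less: "(qseries q f (q powr (\<mu> + \<alpha>)) x / qpoch_inf (q powr (\<mu> + \<alpha>)) q)
      * (qseries q f (q powr (\<mu> + \<beta>)) x / qpoch_inf (q powr (\<mu> + \<beta>)) q) < U * V" .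
  have alg: "Pa * Pd / (Pb * Pc) < A * D / (B * C)"
    if "(B / Pb) * (C / Pc) < (A / Pa) * (D / Pd)" "0 < Pa" "0 < Pd" "0 < B" "0 < C"
    for A B C D Pa Pb Pc Pd :: real
  proof -
    have "(B / Pb) * (C / Pc) * (Pa * Pd / (B * C)) < (A / Pa) * (D / Pd) * (Pa * Pd / (B * C))"
      using that by (intro mult_strict_right_mono) auto
    then show ?thesis using that by simp
  qed
  show ?thesis
    by (intro alg[OF less[unfolded U_def V_def]] F P) (use pos in auto)
qed

section \<open>The q-gamma ratio, boundary values and assembly\<close>

text \<open>The powers of \<open>1 - q\<close> have total exponent
  \<open>2 - 2\<mu> - \<alpha> - \<beta>\<close> above and below, and the factors
  \<open>(q;q)_\<infinity>\<close> cancel. At \<open>\<mu> = 0\<close> both sides are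
  \<open>0\<close> by totalised division.\<close>

lemma qGamma_ratio:
  assumes q: "0 < q" "q < 1" and "0 \<le> \<mu>" "0 < \<alpha>" "0 < \<beta>"
  shows "qGamma q (\<mu> + \<alpha>) * qGamma q (\<mu> + \<beta>) / (qGamma q \<mu> * qGamma q (\<mu> + \<alpha> + \<beta>))
    = qpoch_inf (q powr \<mu>) q * qpoch_inf (q powr (\<mu> + \<alpha> + \<beta>)) q
        / (qpoch_inf (q powr (\<mu> + \<alpha>)) q * qpoch_inf (q powr (\<mu> + \<beta>)) q)"
proof -
  define r where "r = 1 - q"
  have P: "0 < qpoch_inf q q"
    using qpoch_inf_lim(2)[OF q q] .
  have e: "r powr (1 - (\<mu> + \<alpha>)) * r powr (1 - (\<mu> + \<beta>)) = r powr (1 - \<mu>) * r powr (1 - (\<mu> + \<alpha> + \<beta>))"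
    by (simp add: algebra_simps flip: powr_add)
  have r: "0 < r" using q by (simp add: r_def)
  have alg: "(X1 * (p / B)) * (X2 * (p / C)) / ((X3 * (p / A)) * (X4 * (p / D))) = A * D / (B * C)"
    if "X1 * X2 = X3 * X4" "0 < X3" "0 < X4" "0 < p" for X1 X2 X3 X4 A B C D p :: real
  proof -
    have "(X1 * (p / B)) * (X2 * (p / C)) / ((X3 * (p / A)) * (X4 * (p / D)))
      = (X1 * X2) / (X3 * X4) * (A * D / (B * C))"
      using that(2-4) by (simp add: field_simps)
    then show ?thesis using that by simp
  qed
  show ?thesis
    unfolding qGamma_def r_def[symmetric] using e r P by (intro alg) auto
qed

lemma qseries_1: "qseries q f 1 x = f 0"
proof -
  have "(\<lambda>n. qcoeff q f 1 n * x ^ n) sums (\<Sum>n\<in>{0}. qcoeff q f 1 n * x ^ n)"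
    by (rule sums_finite) (auto simp: qcoeff_def qpoch_one)
  then show ?thesis
    by (simp add: qseries_def sums_iff qcoeff_def)
qed

lemma qseries_at_0: "qseries q f a 0 = f 0"
  unfolding qseries_def powser_zero by (simp add: qcoeff_def)

lemma qDelta_commute: "qDelta q f \<mu> \<alpha> \<beta> x = qDelta q f \<mu> \<beta> \<alpha> x"
  by (simp add: qDelta_def mult.commute add_ac)

lemma qDelta_lower_bound:
  fixes f :: "nat \<Rightarrow> real"
  assumes q: "0 < q" "q < 1" and pos: "0 \<le> \<mu>" "0 < \<alpha>" "0 < \<beta>"
    and f: "doubly_positive f" and x: "0 \<le> x" "ereal x < qradius q f"
  shows "f 0 * f 1 * (1 - q powr \<alpha>) * (1 - q powr \<beta>) * (q powr \<mu> * x / (1 - q)) \<le> qDelta q f \<mu> \<alpha> \<beta> x"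
    and "\<exists>n\<ge>1. f n \<noteq> 0 \<Longrightarrow> 0 < x \<Longrightarrow>
      f 0 * f 1 * (1 - q powr \<alpha>) * (1 - q powr \<beta>) * (q powr \<mu> * x / (1 - q)) < qDelta q f \<mu> \<alpha> \<beta> x"
proof -
  \<comment> \<open>\<open>qseries_lower_bound\<close> asks for \<open>c \<le> b\<close>, that is
    \<open>s \<le> t\<close>; the other order follows from the symmetry of
    \<open>\<Delta>\<close>.\<close>
  have ordered:
    "f 0 * f 1 * (1 - q powr s) * (1 - q powr t) * (q powr \<mu> * x / (1 - q)) \<le> qDelta q f \<mu> s t x
     \<and> ((\<exists>n\<ge>1. f n \<noteq> 0) \<and> 0 < x \<longrightarrow>
      f 0 * f 1 * (1 - q powr s) * (1 - q powr t) * (q powr \<mu> * x / (1 - q)) < qDelta q f \<mu> s t x)"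
    if st: "0 < s" "s \<le> t" for s t
  proof -
    have ord: "0 < q powr (\<mu> + s + t)" "q powr (\<mu> + s + t) < q powr (\<mu> + t)"
      "q powr (\<mu> + t) \<le> q powr (\<mu> + s)" "q powr (\<mu> + s) < q powr \<mu>" "q powr \<mu> \<le> 1"
      using q st pos powr_mono'[of 0 \<mu> q] by (auto intro!: powr_less_mono' powr_mono')
    have prod: "q powr \<mu> * q powr (\<mu> + s + t) = q powr (\<mu> + s) * q powr (\<mu> + t)"
      by (simp add: algebra_simps flip: powr_add)
    have "f 0 * f 1 * ((q powr \<mu> + q powr (\<mu> + s + t) - q powr (\<mu> + s) - q powr (\<mu> + t)) / (1 - q)) * x
      = f 0 * f 1 * (1 - q powr s) * (1 - q powr t) * (q powr \<mu> * x / (1 - q))"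
      by (simp add: powr_add algebra_simps add_divide_distrib diff_divide_distrib)
    then show ?thesis
      using qseries_lower_bound[OF q ord prod f x] unfolding qDelta_def by metis
  qed
  have "f 0 * f 1 * (1 - q powr \<alpha>) * (1 - q powr \<beta>) * (q powr \<mu> * x / (1 - q)) \<le> qDelta q f \<mu> \<alpha> \<beta> x
     \<and> ((\<exists>n\<ge>1. f n \<noteq> 0) \<and> 0 < x \<longrightarrow>
      f 0 * f 1 * (1 - q powr \<alpha>) * (1 - q powr \<beta>) * (q powr \<mu> * x / (1 - q)) < qDelta q f \<mu> \<alpha> \<beta> x)"
  proof (cases "\<alpha> \<le> \<beta>")
    case True
    then show ?thesis using ordered pos by blast
  next
    case False
    then have "\<beta> \<le> \<alpha>" by simp
    moreover have "f 0 * f 1 * (1 - q powr \<alpha>) * (1 - q powr \<beta>) = f 0 * f 1 * (1 - q powr \<beta>) * (1 - q powr \<alpha>)"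
      by simp
    ultimately show ?thesis
      using ordered[of \<beta> \<alpha>] pos(3) qDelta_commute[of q f \<mu> \<alpha> \<beta> x] by metis
  qed
  then show "f 0 * f 1 * (1 - q powr \<alpha>) * (1 - q powr \<beta>) * (q powr \<mu> * x / (1 - q)) \<le> qDelta q f \<mu> \<alpha> \<beta> x"
    and "\<exists>n\<ge>1. f n \<noteq> 0 \<Longrightarrow> 0 < x \<Longrightarrow>
      f 0 * f 1 * (1 - q powr \<alpha>) * (1 - q powr \<beta>) * (q powr \<mu> * x / (1 - q)) < qDelta q f \<mu> \<alpha> \<beta> x"
    by blast+
qed

text \<open>The side conditions separate degenerate cases. If \<open>f 0 = 0\<close> and
  \<open>\<mu> = 0\<close>, both sides of the gamma bound are \<open>0\<close>; if
  \<open>f 0 = 0\<close> and \<open>x = 0\<close>, the quotient of series is \<open>0/0\<close>,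
  hence \<open>0\<close>, which is why quotient \<open>1\<close> only implies \<open>x = 0\<close>.
  If \<open>f n = 0\<close> for all \<open>n \<ge> 1\<close>, the series are constant and equality
  holds for every \<open>x\<close>.\<close>

theorem corollary2p3:
  fixes q \<mu> \<alpha> \<beta> x :: real and f :: "nat \<Rightarrow> real"
  assumes "0 < q" and "q < 1"
    and "0 < \<alpha>" and "0 < \<beta>" and "0 \<le> \<mu>"
    and "0 \<le> x" and "ereal x < qradius q f"
  shows
    "(doubly_positive f \<longrightarrow>
        (f 0 \<noteq> 0 \<or> 0 < \<mu> \<and> 0 < x \<longrightarrow>
          qGamma q (\<mu> + \<alpha>) * qGamma q (\<mu> + \<beta>) / (qGamma q \<mu> * qGamma q (\<mu> + \<alpha> + \<beta>))
          < qseries q f (q powr \<mu>) x * qseries q f (q powr (\<mu> + \<alpha> + \<beta>)) x /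
            (qseries q f (q powr (\<mu> + \<alpha>)) x * qseries q f (q powr (\<mu> + \<beta>)) x)) \<and>
        qseries q f (q powr \<mu>) x * qseries q f (q powr (\<mu> + \<alpha> + \<beta>)) x /
          (qseries q f (q powr (\<mu> + \<alpha>)) x * qseries q f (q powr (\<mu> + \<beta>)) x) \<le> 1 \<and>
        f 0 * f 1 * (1 - q powr \<alpha>) * (1 - q powr \<beta>) * (q powr \<mu> * x / (1 - q))
          \<le> qDelta q f \<mu> \<alpha> \<beta> x \<and>
        (f 0 \<noteq> 0 \<or> 0 < \<mu> \<and> 0 < x \<longrightarrow>
          qDelta q f \<mu> \<alpha> \<beta> x
          < (1 - qGamma q (\<mu> + \<alpha>) * qGamma q (\<mu> + \<beta>) / (qGamma q \<mu> * qGamma q (\<mu> + \<alpha> + \<beta>)))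
            * qseries q f (q powr (\<mu> + \<alpha>)) x * qseries q f (q powr (\<mu> + \<beta>)) x) \<and>
        ((\<exists>n\<ge>1. f n \<noteq> 0) \<longrightarrow>
          (qseries q f (q powr \<mu>) x * qseries q f (q powr (\<mu> + \<alpha> + \<beta>)) x /
            (qseries q f (q powr (\<mu> + \<alpha>)) x * qseries q f (q powr (\<mu> + \<beta>)) x) = 1
            \<longrightarrow> x = 0) \<and>
          (f 0 * f 1 * (1 - q powr \<alpha>) * (1 - q powr \<beta>) * (q powr \<mu> * x / (1 - q))
            = qDelta q f \<mu> \<alpha> \<beta> x \<longleftrightarrow> x = 0))) \<and>
     ((\<forall>n. 0 \<le> f n) \<and> (\<exists>n. f n \<noteq> 0) \<longrightarrow>
        (f 0 \<noteq> 0 \<or> 0 < x \<longrightarrow>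
          qGamma q (\<mu> + \<alpha>) * qGamma q (\<mu> + \<beta>) / (qGamma q \<mu> * qGamma q (\<mu> + \<alpha> + \<beta>))
          \<le> qseries q f (q powr \<mu>) x * qseries q f (q powr (\<mu> + \<alpha> + \<beta>)) x /
            (qseries q f (q powr (\<mu> + \<alpha>)) x * qseries q f (q powr (\<mu> + \<beta>)) x)) \<and>
        (f 0 \<noteq> 0 \<or> 0 < \<mu> \<and> 0 < x \<longrightarrow>
          qGamma q (\<mu> + \<alpha>) * qGamma q (\<mu> + \<beta>) / (qGamma q \<mu> * qGamma q (\<mu> + \<alpha> + \<beta>))
          < qseries q f (q powr \<mu>) x * qseries q f (q powr (\<mu> + \<alpha> + \<beta>)) x /
            (qseries q f (q powr (\<mu> + \<alpha>)) x * qseries q f (q powr (\<mu> + \<beta>)) x)) \<and>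
        qDelta q f \<mu> \<alpha> \<beta> x
          \<le> (1 - qGamma q (\<mu> + \<alpha>) * qGamma q (\<mu> + \<beta>) / (qGamma q \<mu> * qGamma q (\<mu> + \<alpha> + \<beta>)))
            * qseries q f (q powr (\<mu> + \<alpha>)) x * qseries q f (q powr (\<mu> + \<beta>)) x \<and>
        (f 0 \<noteq> 0 \<or> 0 < \<mu> \<and> 0 < x \<longrightarrow>
          qDelta q f \<mu> \<alpha> \<beta> x
          < (1 - qGamma q (\<mu> + \<alpha>) * qGamma q (\<mu> + \<beta>) / (qGamma q \<mu> * qGamma q (\<mu> + \<alpha> + \<beta>)))
            * qseries q f (q powr (\<mu> + \<alpha>)) x * qseries q f (q powr (\<mu> + \<beta>)) x))"
proof -
  define A B C D where "A = qseries q f (q powr \<mu>) x" and "B = qseries q f (q powr (\<mu> + \<alpha>)) x"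
    and "C = qseries q f (q powr (\<mu> + \<beta>)) x" and "D = qseries q f (q powr (\<mu> + \<alpha> + \<beta>)) x"
  define G where "G = qGamma q (\<mu> + \<alpha>) * qGamma q (\<mu> + \<beta>) / (qGamma q \<mu> * qGamma q (\<mu> + \<alpha> + \<beta>))"
  define L where "L = f 0 * f 1 * (1 - q powr \<alpha>) * (1 - q powr \<beta>) * (q powr \<mu> * x / (1 - q))"
  note q = assms(1,2) and x = assms(6,7)
  have Delta: "qDelta q f \<mu> \<alpha> \<beta> x = B * C - A * D"
    by (simp add: qDelta_def A_def B_def C_def D_def)
  have powr01: "0 < q powr t" "q powr t < 1" if "0 < t" for t
    using powr_less_mono'[of q 0 t] that q by auto
  \<comment> \<open>At \<open>\<mu> = 0\<close> the parameter is \<open>1\<close>: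
    \<open>qpoch_inf 1 q = 0\<close> makes the gamma ratio vanish, and the first series collapses to
    \<open>f 0\<close>.\<close>
  have G0: "G = 0" "A = f 0" if "\<mu> = 0"
    using that q unfolding G_def A_def by (simp_all add: qGamma_def qpoch_inf_1 qseries_1)
  have nontrivial: "\<exists>n. 0 < f n * x ^ n" if f: "\<forall>n. 0 \<le> f n" "\<exists>n. f n \<noteq> 0" and c: "f 0 \<noteq> 0 \<or> 0 < x"
  proof (cases "f 0 = 0")
    case True
    obtain n where "f n \<noteq> 0" using f(2) by blast
    then have "0 < f n" using f(1) by (simp add: less_le)
    then show ?thesis using True c by (intro exI[of _ n]) simp
  next
    case False
    then have "0 < f 0" using f(1) by (simp add: less_le)
    then show ?thesis by (intro exI[of _ 0]) simp
  qed
  have pos: "0 < B" "0 < C" "0 < D" if "\<forall>n. 0 \<le> f n" "\<exists>n. f n \<noteq> 0" "f 0 \<noteq> 0 \<or> 0 < x"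
    using nontrivial[OF that] qseries_pos[OF q powr01 _ x] that(1) assms(3-5)
    unfolding B_def C_def D_def by auto
  have strict: "G < A * D / (B * C)"
    if f: "\<forall>n. 0 \<le> f n" "\<exists>n. f n \<noteq> 0" and c: "f 0 \<noteq> 0 \<or> 0 < \<mu> \<and> 0 < x"
  proof (cases "\<mu> = 0")
    case True
    then have "0 < f 0" using f c by (simp add: less_le)
    then show ?thesis using G0[OF True] pos[OF f] by simp
  next
    case False
    obtain n where n: "0 < f n * x ^ n" using nontrivial[OF f] c by blast
    have "0 < \<mu>" using False assms(5) by simp
    from qseries_upper_bound[OF q this assms(3,4) _ x n] f(1)
    show ?thesis
      unfolding G_def A_def B_def C_def D_def qGamma_ratio[OF q assms(5,3,4)] by simp
  qed
  have weak: "G \<le> A * D / (B * C)"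
    if f: "\<forall>n. 0 \<le> f n" "\<exists>n. f n \<noteq> 0" and c: "f 0 \<noteq> 0 \<or> 0 < x"
  proof (cases "\<mu> = 0")
    case True
    then show ?thesis using G0[OF True] pos[OF f c] f(1) by simp
  next
    case False
    then show ?thesis using strict[OF f] c assms(5) by simp
  qed
  have strict': "B * C - A * D < (1 - G) * B * C"
    if f: "\<forall>n. 0 \<le> f n" "\<exists>n. f n \<noteq> 0" and c: "f 0 \<noteq> 0 \<or> 0 < \<mu> \<and> 0 < x"
    using strict[OF that] pos[OF f] c by (auto simp: pos_less_divide_eq algebra_simps)
  \<comment> \<open>In the remaining case \<open>f 0 = 0\<close>, \<open>x = 0\<close>, the bound on
    the quotient reads \<open>0 \<le> 1\<close> and the weak bound on \<open>\<Delta>\<close> reads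
    \<open>0 \<le> 0\<close>.\<close>
  have zero: "A = 0" "B = 0" "C = 0" if "\<not> (f 0 \<noteq> 0 \<or> 0 < x)"
  proof -
    have "f 0 = 0" "x = 0" using that x(1) by auto
    then show "A = 0" "B = 0" "C = 0" by (simp_all add: A_def B_def C_def qseries_at_0)
  qed
  have weak': "B * C - A * D \<le> (1 - G) * B * C" if f: "\<forall>n. 0 \<le> f n" "\<exists>n. f n \<noteq> 0"
  proof (cases "f 0 \<noteq> 0 \<or> 0 < x")
    case True
    then show ?thesis
      using weak[OF f True] pos[OF f True] by (simp add: pos_le_divide_eq algebra_simps)
  next
    case False
    then show ?thesis using zero by simp
  qed
  have lower: "A * D / (B * C) \<le> 1 \<and> L \<le> B * C - A * D \<and>
      ((\<exists>n\<ge>1. f n \<noteq> 0) \<longrightarrow> (A * D / (B * C) = 1 \<longrightarrow> x = 0) \<and> (L = B * C - A * D \<longleftrightarrow> x = 0))"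
    if dp: "doubly_positive f"
  proof -
    have f: "\<forall>n. 0 \<le> f n" "\<exists>n. f n \<noteq> 0"
      using dp by (auto simp: doubly_positive_def)
    note lb = qDelta_lower_bound[OF q assms(5,3,4) dp x, unfolded Delta, folded L_def]
    have "0 \<le> L"
      unfolding L_def using f(1) q x(1) powr01(2)[OF assms(3)] powr01(2)[OF assms(4)]
      by (intro mult_nonneg_nonneg) auto
    then have le: "A * D \<le> B * C" using lb(1) by simp
    have "A * D / (B * C) \<le> 1"
    proof (cases "f 0 \<noteq> 0 \<or> 0 < x")
      case True
      then show ?thesis using le pos[OF f True] by simp
    next
      case False
      then show ?thesis using zero by simp
    qed
    moreover have "x = 0" if "\<exists>n\<ge>1. f n \<noteq> 0" "A * D / (B * C) = 1 \<or> L = B * C - A * D"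
    proof (rule ccontr)
      assume "x \<noteq> 0"
      then have x0: "0 < x" using x(1) by simp
      then have "L < B * C - A * D" using lb(2) that(1) by blast
      moreover have "0 < B * C" using pos[OF f] x0 by simp
      ultimately show False using that(2) \<open>0 \<le> L\<close> by auto
    qed
    moreover have "L = B * C - A * D" if "x = 0"
      using that by (simp add: L_def A_def B_def C_def D_def qseries_at_0)
    ultimately show ?thesis using lb(1) by blast
  qed
  have dp: "(\<forall>n. 0 \<le> f n) \<and> (\<exists>n. f n \<noteq> 0)" if "doubly_positive f"
    using that by (auto simp: doubly_positive_def)
  show ?thesis
    unfolding Delta A_def[symmetric] B_def[symmetric] C_def[symmetric] D_def[symmetric]
      G_def[symmetric] L_def[symmetric]
    using strict weak strict' weak' lower dp by blast
qed

end
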